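(* Let $n\ge 1$. For any two Young diagrams $D,E\in\mathcal{Y}_n$: (1) (Intertwinity) $\langle Y_E(sgn),Y_D\rangle=0$ if and only if $E\not\preceq D^t$; and $\langle Y_E(sgn),Y_D\rangle=1$ if $E=D^t$. (2) (Monotonicity) ($D\preceq E$ and $D\ne E$) if and only if $Y_E\lneqq Y_D$.
   Context: All representations are finite-dimensional and complex. $\mathcal{Y}_n$ is the set of Young diagrams (partitions) $D=(d_1\ge\dots\ge d_r)$ with $d_1+\dots+d_r=n$ (trailing zeros are ignored); $D^t$ is the transpose diagram. Dominance order $\preceq$ on $\mathcal{Y}_n$: the order generated by the relations $D\preceq D'$ whenever $D$ is obtained from $D'$ by moving one box of $D'$ to a (perhaps new) lower row. For $D=(d_1\ge\dots\ge d_r)\in\mathcal{Y}_n$, $S_D\cong S_{d_1}\times\dots\times S_{d_r}\subset S_n$ is the subgroup preserving each of the blocks $\{1,\dots,d_1\},\{d_1+1,\dots,d_1+d_2\},\dots$. The Young module is $Y_D=\mathrm{Ind}_{S_D}^{S_n}(\mathbf{1})$, and the twisted Young module is $Y_D(sgn)=\mathrm{Ind}_{S_D}^{S_n}(sgn|_{S_D})$, where $sgn$ is the sign representation of $S_n$. For representations $\pi,\tau$ of a finite group $G$, $\langle\pi,\tau\rangle=\dim \mathrm{Hom}_G(\pi,\tau)$ is the intertwining number. $\pi\lneqq\tau$ means that $\pi$ is isomorphic to a proper subrepresentation of $\tau$. *)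

theory Defs
  imports Complex_Main "HOL-Library.Function_Algebras" "HOL-Algebra.Sym_Groups"
begin

section \<open>Complex vector spaces\<close>

class complex_vector = ab_group_add +
  fixes scaleC :: "complex \<Rightarrow> 'a \<Rightarrow> 'a"  (infixr "*\<^sub>C" 75)
  assumes scaleC_add_right: "a *\<^sub>C (x + y) = a *\<^sub>C x + a *\<^sub>C y"
    and scaleC_add_left: "(a + b) *\<^sub>C x = a *\<^sub>C x + b *\<^sub>C x"
    and scaleC_scaleC: "a *\<^sub>C b *\<^sub>C x = (a * b) *\<^sub>C x"
    and scaleC_one: "1 *\<^sub>C x = x"

global_interpretation complex_vector: vector_space
  "scaleC :: complex \<Rightarrow> 'a \<Rightarrow> 'a :: complex_vector"
  by unfold_locales
    (simp_all add: scaleC_add_right scaleC_add_left scaleC_scaleC scaleC_one)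

instantiation complex :: complex_vector
begin

definition scaleC_complex :: "complex \<Rightarrow> complex \<Rightarrow> complex"
  where "scaleC_complex c z = c * z"

instance
  by standard (simp_all add: scaleC_complex_def algebra_simps)

end

instantiation "fun" :: (type, complex_vector) complex_vector
begin

definition scaleC_fun :: "complex \<Rightarrow> ('a \<Rightarrow> 'b) \<Rightarrow> 'a \<Rightarrow> 'b"
  where "scaleC_fun c f = (\<lambda>x. c *\<^sub>C f x)"

instance
  by standard
    (simp_all add: scaleC_fun_def fun_eq_iff scaleC_add_right scaleC_add_left scaleC_scaleC
      scaleC_one)

end

lemma scaleC_fun_apply [simp]: "(c *\<^sub>C f) x = c *\<^sub>C f x"
  by (simp add: scaleC_fun_def)

definition clinear_on :: "'v set \<Rightarrow> ('v::complex_vector \<Rightarrow> 'w::complex_vector) \<Rightarrow> bool"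
  where "clinear_on V f \<longleftrightarrow>
    (\<forall>u\<in>V. \<forall>v\<in>V. f (u + v) = f u + f v) \<and> (\<forall>c. \<forall>v\<in>V. f (c *\<^sub>C v) = c *\<^sub>C f v)"

definition fin_dim :: "'v::complex_vector set \<Rightarrow> bool"
  where "fin_dim V \<longleftrightarrow> (\<exists>B. finite B \<and> V \<subseteq> complex_vector.span B)"


section \<open>Representations\<close>

text \<open>
  The group is not part of the record, so restricting a representation of a group to a subgroup
  leaves the record unchanged. Values of the action outside \<open>vspace\<close> or outside the carrier of
  the group are irrelevant.
\<close>

record ('g, 'v) rep =
  vspace :: "'v set"
  act :: "'g \<Rightarrow> 'v \<Rightarrow> 'v"

definition is_rep :: "('g, 'm) monoid_scheme \<Rightarrow> ('g, 'v::complex_vector) rep \<Rightarrow> bool"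
  where "is_rep G \<pi> \<longleftrightarrow>
    complex_vector.subspace (vspace \<pi>) \<and> fin_dim (vspace \<pi>) \<and>
    (\<forall>g\<in>carrier G. clinear_on (vspace \<pi>) (act \<pi> g) \<and> act \<pi> g ` vspace \<pi> \<subseteq> vspace \<pi>) \<and>
    (\<forall>v\<in>vspace \<pi>. act \<pi> \<one>\<^bsub>G\<^esub> v = v) \<and>
    (\<forall>g\<in>carrier G. \<forall>h\<in>carrier G. \<forall>v\<in>vspace \<pi>. act \<pi> (g \<otimes>\<^bsub>G\<^esub> h) v = act \<pi> g (act \<pi> h v))"

text \<open>
  Elements of \<open>Hom\<^sub>G(\<pi>, \<tau>)\<close> are normalised to vanish outside \<open>vspace \<pi>\<close>, so that
  distinct elements are distinct linear maps on \<open>vspace \<pi>\<close> and the library dimension of this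
  set of functions is the intended one.
\<close>

definition intertwiners ::
  "('g, 'm) monoid_scheme \<Rightarrow> ('g, 'v::complex_vector) rep \<Rightarrow> ('g, 'w::complex_vector) rep
    \<Rightarrow> ('v \<Rightarrow> 'w) set"
  where "intertwiners G \<pi> \<tau> =
    {f. (\<forall>v. v \<notin> vspace \<pi> \<longrightarrow> f v = 0) \<and> f ` vspace \<pi> \<subseteq> vspace \<tau> \<and> clinear_on (vspace \<pi>) f \<and>
        (\<forall>g\<in>carrier G. \<forall>v\<in>vspace \<pi>. f (act \<pi> g v) = act \<tau> g (f v))}"

definition intertwining_number ::
  "('g, 'm) monoid_scheme \<Rightarrow> ('g, 'v::complex_vector) rep \<Rightarrow> ('g, 'w::complex_vector) rep \<Rightarrow> nat"
  where "intertwining_number G \<pi> \<tau> = complex_vector.dim (intertwiners G \<pi> \<tau>)"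

definition rep_iso ::
  "('g, 'm) monoid_scheme \<Rightarrow> ('g, 'v::complex_vector) rep \<Rightarrow> ('g, 'w::complex_vector) rep \<Rightarrow> bool"
  where "rep_iso G \<pi> \<tau> \<longleftrightarrow> (\<exists>f\<in>intertwiners G \<pi> \<tau>. bij_betw f (vspace \<pi>) (vspace \<tau>))"

definition invariant_subspace ::
  "('g, 'm) monoid_scheme \<Rightarrow> 'v set \<Rightarrow> ('g, 'v::complex_vector) rep \<Rightarrow> bool"
  where "invariant_subspace G W \<tau> \<longleftrightarrow>
    complex_vector.subspace W \<and> W \<subseteq> vspace \<tau> \<and> (\<forall>g\<in>carrier G. act \<tau> g ` W \<subseteq> W)"

definition iso_proper_subrep ::
  "('g, 'm) monoid_scheme \<Rightarrow> ('g, 'v::complex_vector) rep \<Rightarrow> ('g, 'w::complex_vector) rep \<Rightarrow> bool"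
  where "iso_proper_subrep G \<pi> \<tau> \<longleftrightarrow>
    (\<exists>W. invariant_subspace G W \<tau> \<and> W \<noteq> vspace \<tau> \<and> rep_iso G \<pi> (\<tau>\<lparr>vspace := W\<rparr>))"

text \<open>
  The induced representation is realised on the functions \<open>f : G \<rightarrow> V\<close> with
  \<open>f (h x) = h (f x)\<close> for \<open>h\<close> in the subgroup, with \<open>G\<close> acting by right translation. Functions
  are extended by zero outside the carrier.
\<close>

definition ind_rep ::
  "('g, 'm) monoid_scheme \<Rightarrow> 'g set \<Rightarrow> ('g, 'v::complex_vector) rep \<Rightarrow> ('g, 'g \<Rightarrow> 'v) rep"
  where "ind_rep G H \<pi> =
    \<lparr>vspace = {f. (\<forall>x. x \<notin> carrier G \<longrightarrow> f x = 0) \<and> (\<forall>x\<in>carrier G. f x \<in> vspace \<pi>) \<and>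
                   (\<forall>h\<in>H. \<forall>x\<in>carrier G. f (h \<otimes>\<^bsub>G\<^esub> x) = act \<pi> h (f x))},
     act = (\<lambda>g f x. if x \<in> carrier G then f (x \<otimes>\<^bsub>G\<^esub> g) else 0)\<rparr>"

definition trivial_rep :: "('g, complex) rep"
  where "trivial_rep = \<lparr>vspace = UNIV, act = (\<lambda>g z. z)\<rparr>"

definition sign_rep :: "(nat \<Rightarrow> nat, complex) rep"
  where "sign_rep = \<lparr>vspace = UNIV, act = (\<lambda>p z. of_int (sign p) * z)\<rparr>"


section \<open>Young diagrams\<close>

text \<open>A Young diagram is the list of its nonzero row lengths.\<close>

definition young_diagrams :: "nat \<Rightarrow> nat list set"
  where "young_diagrams n = {D. sorted_wrt (\<ge>) D \<and> 0 \<notin> set D \<and> sum_list D = n}"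

definition row :: "nat list \<Rightarrow> nat \<Rightarrow> nat"
  where "row D i = (if i < length D then D ! i else 0)"

definition transpose_diagram :: "nat list \<Rightarrow> nat list"
  where "transpose_diagram D = map (\<lambda>j. card {i. j < row D i}) [0..<row D 0]"

definition box_move :: "nat list \<Rightarrow> nat list \<Rightarrow> bool"
  where "box_move D D' \<longleftrightarrow>
    (\<exists>i j. i < j \<and> 0 < row D' i \<and> row D = (row D')(i := row D' i - 1, j := row D' j + 1))"

text \<open>All intermediate stages of a chain of box moves have to be Young diagrams.\<close>

definition dominance :: "nat \<Rightarrow> nat list \<Rightarrow> nat list \<Rightarrow> bool"
  where "dominance n =
    (\<lambda>D D'. D \<in> young_diagrams n \<and> D' \<in> young_diagrams n \<and> box_move D D')\<^sup>*\<^sup>*"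


section \<open>Young modules\<close>

definition block :: "nat list \<Rightarrow> nat \<Rightarrow> nat set"
  where "block D i = {sum_list (take i D)<..sum_list (take (Suc i) D)}"

definition young_subgroup :: "nat \<Rightarrow> nat list \<Rightarrow> (nat \<Rightarrow> nat) set"
  where "young_subgroup n D =
    {p \<in> carrier (sym_group n). \<forall>i<length D. p ` block D i = block D i}"

definition young_module :: "nat \<Rightarrow> nat list \<Rightarrow> (nat \<Rightarrow> nat, (nat \<Rightarrow> nat) \<Rightarrow> complex) rep"
  where "young_module n D = ind_rep (sym_group n) (young_subgroup n D) trivial_rep"

definition young_module_sgn :: "nat \<Rightarrow> nat list \<Rightarrow> (nat \<Rightarrow> nat, (nat \<Rightarrow> nat) \<Rightarrow> complex) rep"
  where "young_module_sgn n D = ind_rep (sym_group n) (young_subgroup n D) sign_rep"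


section \<open>Well-definedness\<close>

lemma linear_combination_mem_span:
  fixes T :: "'v::complex_vector \<Rightarrow> 'w::complex_vector"
  assumes "clinear_on UNIV T" and "v \<in> complex_vector.span B"
  shows "T v \<in> complex_vector.span (T ` B)"
proof -
  have add: "T (x + y) = T x + T y" and scale: "T (c *\<^sub>C x) = c *\<^sub>C T x" for x y c
    using assms(1) by (auto simp: clinear_on_def)
  have "T 0 = 0"
    using add[of 0 0] by simp
  then have "complex_vector.subspace {v. T v \<in> complex_vector.span (T ` B)}"
    by (auto intro!: complex_vector.subspaceI
        simp: add scale complex_vector.span_zero complex_vector.span_add complex_vector.span_scale)
  moreover have "B \<subseteq> {v. T v \<in> complex_vector.span (T ` B)}"
    by (auto intro: complex_vector.span_base)
  ultimately show ?thesis
    using complex_vector.span_minimal assms(2) by blast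
qed

lemma fin_dim_sum_linear:
  fixes T :: "'i \<Rightarrow> 'v::complex_vector \<Rightarrow> 'w::complex_vector"
  assumes "finite I" and "fin_dim V" and "\<And>i. i \<in> I \<Longrightarrow> clinear_on UNIV (T i)"
    and U: "\<And>u. u \<in> U \<Longrightarrow> \<exists>v. (\<forall>i\<in>I. v i \<in> V) \<and> u = (\<Sum>i\<in>I. T i (v i))"
  shows "fin_dim U"
proof -
  obtain B where B: "finite B" "V \<subseteq> complex_vector.span B"
    using assms(2) by (auto simp: fin_dim_def)
  let ?C = "\<Union>i\<in>I. T i ` B"
  have "u \<in> complex_vector.span ?C" if u: "u \<in> U" for u
  proof -
    obtain v where v: "\<forall>i\<in>I. v i \<in> V" "u = (\<Sum>i\<in>I. T i (v i))"
      using U[OF u] by blast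
    have "T i (v i) \<in> complex_vector.span ?C" if i: "i \<in> I" for i
    proof -
      have "T i (v i) \<in> complex_vector.span (T i ` B)"
        using linear_combination_mem_span[OF assms(3)[OF i]] v(1) i B(2) by blast
      then show ?thesis
        using complex_vector.span_mono[of "T i ` B" ?C] i by blast
    qed
    then show ?thesis
      unfolding v(2) by (rule complex_vector.span_sum)
  qed
  moreover have "finite ?C"
    using assms(1) B(1) by blast
  ultimately show ?thesis
    unfolding fin_dim_def by blast
qed

lemma is_rep_ind_rep:
  fixes \<pi> :: "('g, 'v::complex_vector) rep"
  assumes G: "group G" "finite (carrier G)" and H: "subgroup H G"
    and \<pi>: "is_rep (G\<lparr>carrier := H\<rparr>) \<pi>"
  shows "is_rep G (ind_rep G H \<pi>)"
proof -
  interpret group G by fact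
  interpret H: subgroup H G by fact
  let ?V = "vspace (ind_rep G H \<pi>)"
  have sub: "complex_vector.subspace (vspace \<pi>)" and fd: "fin_dim (vspace \<pi>)"
    and lin: "\<And>h. h \<in> H \<Longrightarrow> clinear_on (vspace \<pi>) (act \<pi> h)"
    using \<pi> by (auto simp: is_rep_def)
  have zero: "act \<pi> h 0 = 0" if "h \<in> H" for h
  proof -
    have "act \<pi> h (0 *\<^sub>C 0) = 0 *\<^sub>C act \<pi> h 0"
      using lin[OF that] complex_vector.subspace_0[OF sub] unfolding clinear_on_def by blast
    then show ?thesis by simp
  qed
  have "complex_vector.subspace ?V"
    using lin zero
    by (intro complex_vector.subspaceI)
      (auto simp: ind_rep_def clinear_on_def complex_vector.subspace_0[OF sub]
        complex_vector.subspace_add[OF sub] complex_vector.subspace_scale[OF sub])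
  moreover have "fin_dim ?V"
  proof (rule fin_dim_sum_linear[OF G(2) fd])
    show "clinear_on UNIV (\<lambda>v y. if y = x then v else 0)" for x :: 'g
      by (auto simp: clinear_on_def fun_eq_iff)
    fix f assume f: "f \<in> ?V"
    have "f = (\<Sum>x\<in>carrier G. (\<lambda>y. if y = x then f x else 0))"
    proof
      fix y
      have *: "(\<Sum>x\<in>A. (\<lambda>y. if y = x then f x else 0)) y = (\<Sum>x\<in>A. if y = x then f x else 0)"
        if "finite A" for A
        using that by (induction A) auto
      show "f y = (\<Sum>x\<in>carrier G. (\<lambda>y. if y = x then f x else 0)) y"
        unfolding *[OF G(2)] using f G(2) by (auto simp: ind_rep_def sum.delta')
    qed
    then show "\<exists>v. (\<forall>x\<in>carrier G. v x \<in> vspace \<pi>) \<and>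
        f = (\<Sum>x\<in>carrier G. (\<lambda>y. if y = x then v x else 0))"
      using f by (intro exI[of _ f]) (auto simp: ind_rep_def)
  qed
  moreover have "clinear_on ?V (act (ind_rep G H \<pi>) g)" for g
    by (auto simp: clinear_on_def ind_rep_def fun_eq_iff)
  moreover have "act (ind_rep G H \<pi>) g ` ?V \<subseteq> ?V" if "g \<in> carrier G" for g
    using that by (auto simp: ind_rep_def m_assoc)
  moreover have "act (ind_rep G H \<pi>) \<one>\<^bsub>G\<^esub> f = f" if "f \<in> ?V" for f
    using that by (auto simp: ind_rep_def fun_eq_iff)
  moreover have "act (ind_rep G H \<pi>) (g \<otimes>\<^bsub>G\<^esub> h) f =
      act (ind_rep G H \<pi>) g (act (ind_rep G H \<pi>) h f)"
    if "g \<in> carrier G" "h \<in> carrier G" for g h f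
    using that by (auto simp: ind_rep_def fun_eq_iff m_assoc)
  ultimately show ?thesis
    unfolding is_rep_def by blast
qed

lemma subspace_intertwiners:
  assumes "is_rep G \<pi>" and "is_rep G \<tau>"
  shows "complex_vector.subspace (intertwiners G \<pi> \<tau>)"
proof -
  have sub: "complex_vector.subspace (vspace \<tau>)"
    and lin: "\<And>g. g \<in> carrier G \<Longrightarrow> clinear_on (vspace \<tau>) (act \<tau> g)"
    using assms(2) by (auto simp: is_rep_def)
  have "act \<tau> g 0 = 0" if "g \<in> carrier G" for g
  proof -
    have "act \<tau> g (0 *\<^sub>C 0) = 0 *\<^sub>C act \<tau> g 0"
      using lin[OF that] complex_vector.subspace_0[OF sub] unfolding clinear_on_def by blast
    then show ?thesis by simp
  qed
  then show ?thesis
    using lin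
    by (intro complex_vector.subspaceI)
      (auto simp: intertwiners_def clinear_on_def image_subset_iff
        complex_vector.subspace_0[OF sub] complex_vector.subspace_add[OF sub]
        complex_vector.subspace_scale[OF sub] scaleC_add_right mult.commute scaleC_scaleC
        algebra_simps)
qed

lemma fin_dim_intertwiners:
  fixes \<pi> :: "('g, 'v::complex_vector) rep" and \<tau> :: "('g, 'w::complex_vector) rep"
  assumes "is_rep G \<pi>" and "is_rep G \<tau>"
  shows "fin_dim (intertwiners G \<pi> \<tau>)"
proof -
  let ?V = "vspace \<pi>"
  have sub: "complex_vector.subspace ?V" and fdV: "fin_dim ?V" and fdW: "fin_dim (vspace \<tau>)"
    using assms by (auto simp: is_rep_def)
  obtain B where B: "B \<subseteq> ?V" "complex_vector.independent B" "?V \<subseteq> complex_vector.span B"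
    using complex_vector.maximal_independent_subset[of ?V] by blast
  obtain C where "finite C" "?V \<subseteq> complex_vector.span C"
    using fdV by (auto simp: fin_dim_def)
  then have fin: "finite B"
    using complex_vector.independent_span_bound[OF _ B(2)] B(1) by blast
  let ?r = "\<lambda>v b. complex_vector.representation B v b"
  show ?thesis
  proof (rule fin_dim_sum_linear[OF fin fdW])
    show "clinear_on UNIV (\<lambda>w v. if v \<in> ?V then ?r v b *\<^sub>C w else (0::'w))" for b
      by (auto simp: clinear_on_def fun_eq_iff scaleC_add_right scaleC_scaleC mult.commute)
    fix f assume f: "f \<in> intertwiners G \<pi> \<tau>"
    have add: "\<And>u v. u \<in> ?V \<Longrightarrow> v \<in> ?V \<Longrightarrow> f (u + v) = f u + f v"
      and scale: "\<And>c v. v \<in> ?V \<Longrightarrow> f (c *\<^sub>C v) = c *\<^sub>C f v"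
      and out: "\<And>v. v \<notin> ?V \<Longrightarrow> f v = 0" and im: "\<And>v. v \<in> ?V \<Longrightarrow> f v \<in> vspace \<tau>"
      using f by (auto simp: intertwiners_def clinear_on_def)
    have f0: "f 0 = 0"
      using scale[of 0 0] complex_vector.subspace_0[OF sub] by simp
    have comb: "f (\<Sum>b\<in>A. c b *\<^sub>C b) = (\<Sum>b\<in>A. c b *\<^sub>C f b) \<and> (\<Sum>b\<in>A. c b *\<^sub>C b) \<in> ?V"
      if "finite A" "A \<subseteq> ?V" for A c
      using that
    proof (induction A)
      case empty
      then show ?case using f0 complex_vector.subspace_0[OF sub] by simp
    next
      case (insert b A)
      then show ?case
        using complex_vector.subspace_scale[OF sub] complex_vector.subspace_add[OF sub]
        by (simp add: add scale)
    qed
    have "f = (\<Sum>b\<in>B. (\<lambda>v. if v \<in> ?V then ?r v b *\<^sub>C f b else 0))"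
    proof
      fix v
      have *: "(\<Sum>b\<in>A. (\<lambda>v. if v \<in> ?V then ?r v b *\<^sub>C f b else 0)) v =
          (\<Sum>b\<in>A. if v \<in> ?V then ?r v b *\<^sub>C f b else 0)" if "finite A" for A
        using that by (induction A) auto
      show "f v = (\<Sum>b\<in>B. (\<lambda>v. if v \<in> ?V then ?r v b *\<^sub>C f b else 0)) v"
      proof (cases "v \<in> ?V")
        case True
        then have "v = (\<Sum>b\<in>B. ?r v b *\<^sub>C b)"
          using complex_vector.sum_representation_eq[OF B(2) _ fin order_refl] B(3) by fastforce
        then show ?thesis
          unfolding *[OF fin] using comb[OF fin B(1), of "?r v"] True by simp
      qed (simp add: *[OF fin] out)
    qed
    then show "\<exists>w. (\<forall>b\<in>B. w b \<in> vspace \<tau>) \<and>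
        f = (\<Sum>b\<in>B. (\<lambda>v. if v \<in> ?V then ?r v b *\<^sub>C w b else 0))"
      using im B(1) by (intro exI[of _ f]) auto
  qed
qed

lemma subgroup_young_subgroup: "subgroup (young_subgroup n D) (sym_group n)"
proof (rule group.subgroupI[OF sym_group_is_group])
  show "young_subgroup n D \<subseteq> carrier (sym_group n)"
    by (auto simp: young_subgroup_def)
  have "id \<in> young_subgroup n D"
    by (simp add: young_subgroup_def sym_group_carrier permutes_id)
  then show "young_subgroup n D \<noteq> {}"
    by blast
next
  fix p assume p: "p \<in> young_subgroup n D"
  then have pc: "p \<in> carrier (sym_group n)"
    by (simp add: young_subgroup_def)
  then have "inj p"
    by (simp add: sym_group_carrier permutes_inj)
  then have "inv' p ` p ` A = A" for A
    by (simp add: image_comp)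
  then have "inv' p ` block D i = block D i" if "i < length D" for i
    using p that unfolding young_subgroup_def by (metis (mono_tags, lifting) mem_Collect_eq)
  then show "inv\<^bsub>sym_group n\<^esub> p \<in> young_subgroup n D"
    using pc by (simp add: young_subgroup_def sym_group_inv_closed)
next
  fix p q assume pq: "p \<in> young_subgroup n D" "q \<in> young_subgroup n D"
  have "(p \<circ> q) ` block D i = block D i" if "i < length D" for i
    using pq that unfolding young_subgroup_def image_comp[symmetric] by simp
  then show "p \<otimes>\<^bsub>sym_group n\<^esub> q \<in> young_subgroup n D"
    using pq unfolding young_subgroup_def sym_group_carrier sym_group_mult
    by (blast intro: permutes_compose)
qed

lemma finite_sym_group: "finite (carrier (sym_group n))"
  by (simp add: sym_group_def finite_permutations)

lemma fin_dim_complex: "fin_dim (UNIV :: complex set)"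
proof -
  have "z \<in> complex_vector.span {1}" for z :: complex
  proof -
    have "z *\<^sub>C 1 \<in> complex_vector.span {1 :: complex}"
      by (intro complex_vector.span_scale complex_vector.span_base) simp
    then show ?thesis
      by (simp only: scaleC_complex_def mult_1_right)
  qed
  then show ?thesis
    unfolding fin_dim_def by (intro exI[of _ "{1}"]) auto
qed

lemma is_rep_trivial_rep: "is_rep G trivial_rep"
  by (auto simp: is_rep_def trivial_rep_def fin_dim_complex clinear_on_def)

lemma is_rep_sign_rep: "is_rep (sym_group n) sign_rep"
proof -
  have "sign (p \<circ> q) = sign p * sign q"
    if "p \<in> carrier (sym_group n)" "q \<in> carrier (sym_group n)" for p q
    using that by (intro sign_compose sym_group_carrier')
  then show ?thesis
    by (auto simp: is_rep_def sign_rep_def fin_dim_complex clinear_on_def scaleC_complex_def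
        sym_group_mult sym_group_one algebra_simps)
qed

lemma is_rep_young_module: "is_rep (sym_group n) (young_module n D)"
  unfolding young_module_def
  by (intro is_rep_ind_rep sym_group_is_group finite_sym_group subgroup_young_subgroup
      is_rep_trivial_rep)

lemma is_rep_young_module_sgn: "is_rep (sym_group n) (young_module_sgn n D)"
  unfolding young_module_sgn_def
proof (intro is_rep_ind_rep sym_group_is_group finite_sym_group subgroup_young_subgroup)
  show "is_rep (sym_group n\<lparr>carrier := young_subgroup n D\<rparr>) sign_rep"
    using is_rep_sign_rep[of n] unfolding is_rep_def young_subgroup_def by auto
qed

end

theory Submission
  imports Defs
begin

text \<open>
  Intertwiners \<open>Y\<^sub>E(sgn) \<rightarrow> Y\<^sub>D\<close> are determined by functions \<open>\<psi>\<close> with \<open>\<psi> (k x h) = sgn h \<psi> x\<close>, which live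
  on the double cosets whose matrix of block intersections has entries in \<open>{0, 1}\<close>. A matrix with
  entries 0, 1, row sums \<open>E\<close> and column sums \<open>D\<close> exists iff \<open>E \<preceq> D\<^sup>t\<close> (Gale-Ryser), and it is unique
  if \<open>E = D\<^sup>t\<close>.

  If \<open>D\<close> arises from \<open>E\<close> by moving a box, an embedding \<open>Y\<^sub>E \<rightarrow> Y\<^sub>D\<close> is given by summing over the changes of
  one letter in a word; it is injective by a commutator identity as for \<open>sl\<^sub>2\<close>. Conversely, an
  embedding \<open>Y\<^sub>E \<rightarrow> Y\<^sub>D\<close> carries the nonzero intertwiner from \<open>Y\<^sub>F(sgn)\<close>, \<open>F = E\<^sup>t\<close>, to \<open>Y\<^sub>D\<close>, so that
  \<open>E\<^sup>t \<preceq> D\<^sup>t\<close> and hence \<open>D \<preceq> E\<close>.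
\<close>

section \<open>Young diagrams and dominance\<close>

text \<open>Dominance is generated by moves between genuine diagrams, so an inequality of partial
  sums has to be turned into a chain that never leaves the diagrams; this shapes the choice of rows
  in the combinatorial part. The test module F = E^t detects E because the cells of a transposed
  diagram always form a suitable matrix, so a nonzero map into Y_E exists without any search. The
  resulting inequality is one between sums \<open>min (row E i) k\<close>, the partial sums of
  transposes, and is turned back into partial sums of E and D directly. Multiplicity one holds
  because uniqueness of the matrix leaves a single double coset on which \<psi> can be nonzero. The
  two letter-moving operators lead from one content to another, so the norm argument runs on
  functions on a finite set of words of all contents. Its constant is
  \<open>row E i - row E j\<close>, which is positive because the target of the box move is again a
  diagram. Properness is a separate matter: embeddings in both directions give equal partial sums,
  hence equal diagrams, while an injective endomorphism of a finite-dimensional space is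
  onto.\<close>

definition psum :: "nat list \<Rightarrow> nat \<Rightarrow> nat"
  where "psum D k = (\<Sum>i<k. row D i)"

lemma psum_Suc [simp]: "psum D (Suc k) = psum D k + row D k"
  by (simp add: psum_def)

lemma row_antimono:
  assumes "D \<in> young_diagrams n" and "i \<le> j"
  shows "row D j \<le> row D i"
  using assms sorted_wrt_nth_less[of "(\<ge>)" D i j]
  by (cases "i = j") (auto simp: young_diagrams_def row_def)

lemma row_pos_iff:
  assumes "D \<in> young_diagrams n"
  shows "0 < row D i \<longleftrightarrow> i < length D"
  using assms by (auto simp: young_diagrams_def row_def) (metis gr0I nth_mem)

lemma psum_length: "psum D (length D) = sum_list D"
  by (simp add: psum_def row_def sum_list_sum_nth atLeast0LessThan)

lemma psum_eq_sum_list: "length D \<le> k \<Longrightarrow> psum D k = sum_list D"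
proof (induction k rule: dec_induct)
  case base
  then show ?case by (simp add: psum_length)
qed (simp add: row_def)

lemma length_le_diagram:
  assumes "D \<in> young_diagrams n"
  shows "length D \<le> n"
proof -
  have "length D = (\<Sum>i<length D. 1)" by simp
  also have "\<dots> \<le> psum D (length D)"
    unfolding psum_def using row_pos_iff[OF assms] by (intro sum_mono) (simp add: Suc_leI)
  finally show ?thesis
    using assms by (simp add: psum_length young_diagrams_def)
qed

lemma row_eq_0: "D \<in> young_diagrams n \<Longrightarrow> n \<le> i \<Longrightarrow> row D i = 0"
  using length_le_diagram[of D n] by (simp add: row_def)

lemma psum_diagram: "D \<in> young_diagrams n \<Longrightarrow> n \<le> k \<Longrightarrow> psum D k = n"
  using psum_eq_sum_list[of D k] length_le_diagram[of D n] by (simp add: young_diagrams_def)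

lemma row_inj:
  assumes "D \<in> young_diagrams n" "E \<in> young_diagrams n" and "row D = row E"
  shows "D = E"
proof -
  have "length D = length E"
    using row_pos_iff[OF assms(1)] row_pos_iff[OF assms(2)] assms(3)
    by (metis nat_neq_iff)
  then show ?thesis
    using assms(3) by (intro nth_equalityI) (auto simp: row_def fun_eq_iff split: if_splits)
qed

lemma psum_inj:
  assumes "D \<in> young_diagrams n" "E \<in> young_diagrams n" and "\<And>k. psum D k = psum E k"
  shows "D = E"
proof (rule row_inj[OF assms(1,2)])
  show "row D = row E"
    using assms(3) psum_Suc[of D] psum_Suc[of E] by (metis add_left_cancel ext)
qed

lemma diagram_of_antimono:
  assumes "antimono f" and "\<And>i. N \<le> i \<Longrightarrow> f i = 0" and "(\<Sum>i<N. f i) = n"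
  obtains D where "D \<in> young_diagrams n" and "row D = f"
proof -
  define M where "M = (LEAST m. f m = (0::nat))"
  have M0: "f M = 0" and MN: "M \<le> N"
    using LeastI[of "\<lambda>m. f m = 0" N] Least_le[of "\<lambda>m. f m = 0" N] assms(2)
    unfolding M_def by auto
  have Mpos: "0 < f i" if "i < M" for i
    using that not_less_Least unfolding M_def by blast
  have Mz: "f i = 0" if "M \<le> i" for i
    using antimonoD[OF assms(1) that] M0 by simp
  let ?D = "map f [0..<M]"
  have row: "row ?D = f"
    using Mz by (auto simp: row_def fun_eq_iff)
  have "sum_list ?D = (\<Sum>i<M. f i)"
    by (simp add: sum_list_sum_nth atLeast0LessThan)
  also have "\<dots> = (\<Sum>i<N. f i)"
    using MN Mz by (intro sum.mono_neutral_left) auto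
  finally have "sum_list ?D = n"
    using assms(3) by simp
  moreover have "sorted_wrt (\<ge>) ?D"
    using assms(1) by (auto simp: sorted_wrt_iff_nth_less intro: antimonoD)
  moreover have "0 \<notin> set ?D"
    using Mpos by fastforce
  ultimately show thesis
    using row by (intro that[of ?D]) (auto simp: young_diagrams_def)
qed

text \<open>A prefix loses the moved box exactly if it contains the giving row but not the receiving
  one. The additive form avoids truncated subtraction.\<close>

lemma sum_box_move:
  fixes f :: "nat \<Rightarrow> nat"
  assumes "i < j" and "0 < f i"
  shows "(\<Sum>m<k. (f(i := f i - 1, j := f j + 1)) m) + (if i < k \<and> k \<le> j then 1 else 0)
    = (\<Sum>m<k. f m)"
  using assms by (induction k) auto

text \<open>
  The box is moved inside the leftmost stretch on which the partial sums differ strictly, from the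
  last row of its maximal length to the first row of its minimal length, so that the result is
  again a diagram.
\<close>

lemma majorization_step:
  assumes D: "D \<in> young_diagrams n" and E: "E \<in> young_diagrams n"
    and le: "\<And>k. psum D k \<le> psum E k" and "D \<noteq> E"
  obtains E' where "E' \<in> young_diagrams n" "box_move E' E" "\<And>k. psum D k \<le> psum E' k"
    "(\<Sum>k<n. psum E' k) < (\<Sum>k<n. psum E k)"
proof -
  define i where "i = (LEAST i. row D i \<noteq> row E i)"
  have ex: "\<exists>i. row D i \<noteq> row E i"
    using row_inj[OF D E] \<open>D \<noteq> E\<close> by blast
  have i: "row D i \<noteq> row E i"
    unfolding i_def using ex by (rule LeastI_ex)
  have "row D m = row E m" if "m < i" for m
    using that not_less_Least unfolding i_def by blast
  then have eq: "psum D i = psum E i"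
    by (simp add: psum_def)
  have less_i: "row D i < row E i"
    using le[of "Suc i"] eq i by simp
  \<comment> \<open>The partial sums agree again right after row \<open>j\<close>;
    \<open>Suc j\<close> occurs because \<open>psum\<close> at \<open>j\<close> still excludes row
    \<open>j\<close>.\<close>
  define j where "j = (LEAST j. i < j \<and> psum D (Suc j) = psum E (Suc j))"
  have "i < Suc (i + n) \<and> psum D (Suc (Suc (i + n))) = psum E (Suc (Suc (i + n)))"
    using psum_diagram[OF D, of "Suc (Suc (i + n))"] psum_diagram[OF E, of "Suc (Suc (i + n))"]
    by (simp del: psum_Suc)
  then have j: "i < j" "psum D (Suc j) = psum E (Suc j)"
    unfolding j_def
    using LeastI[of "\<lambda>j. i < j \<and> psum D (Suc j) = psum E (Suc j)" "Suc (i + n)"] by blast+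
  have strict: "psum D k < psum E k" if k: "i < k" "k \<le> j" for k
  proof (cases "k = Suc i")
    case True
    then show ?thesis using less_i eq by simp
  next
    case False
    then obtain m where m: "k = Suc m" "i < m" "m < j"
      using k by (cases k) auto
    then have "psum D k \<noteq> psum E k"
      using not_less_Least[of m "\<lambda>j. i < j \<and> psum D (Suc j) = psum E (Suc j)"]
      unfolding j_def by auto
    then show ?thesis using le[of k] by simp
  qed
  have less_j: "row E j < row D j"
    using strict[of j] j by simp
  \<comment> \<open>A gap of 2 keeps the rows weakly decreasing after the move even if the two rows
    involved are adjacent.\<close>
  have gap: "row E j + 2 \<le> row E i"
    using less_i less_j row_antimono[OF D, of i j] j(1) by simp
  define i' where "i' = Max {m. m \<le> j \<and> row E m = row E i}"
  have "i' \<in> {m. m \<le> j \<and> row E m = row E i}"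
    unfolding i'_def using j(1) by (intro Max_in) (auto intro: exI[of _ i])
  then have i': "i' \<le> j" "row E i' = row E i"
    by auto
  have i'_max: "m \<le> i'" if "m \<le> j" "row E m = row E i" for m
    unfolding i'_def using that by (intro Max_ge) auto
  have ii': "i \<le> i'"
    using j(1) by (intro i'_max) auto
  have i'j: "i' < j"
    using i' gap by (cases "i' = j") auto
  have i'_drop: "row E (Suc i') < row E i'"
    using i'_max[of "Suc i'"] i'j i'(2) row_antimono[OF E, of i' "Suc i'"] by fastforce
  define j' where "j' = (LEAST m. row E m = row E j)"
  have j': "row E j' = row E j"
    unfolding j'_def by (rule LeastI) simp
  have j'j: "j' \<le> j"
    unfolding j'_def by (rule Least_le) simp
  have i'j': "i' < j'"
    using row_antimono[OF E, of j' i'] j' i' gap by (cases "j' \<le> i'") auto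
  have j'_drop: "row E j' < row E m" if "m < j'" for m
    using that not_less_Least[of m "\<lambda>m. row E m = row E j"] j' row_antimono[OF E, of m j']
    unfolding j'_def by fastforce
  let ?f = "(row E)(i' := row E i' - 1, j' := row E j' + 1)"
  have pos: "0 < row E i'"
    using i' gap by simp
  have "?f (Suc m) \<le> ?f m" for m
  proof -
    have "row E (Suc m) \<le> row E m"
      by (rule row_antimono[OF E]) simp
    then show ?thesis
      using i'j' i'_drop j'_drop[of m] i'(2) j' gap by auto
  qed
  then have anti: "antimono ?f"
    by (simp add: antimono_iff_le_Suc)
  \<comment> \<open>The cut-off must include row \<open>j'\<close>, which receives the box and may
    have been empty before.\<close>
  let ?N = "max n (Suc j')"
  have sum: "(\<Sum>m<k. ?f m) + (if i' < k \<and> k \<le> j' then 1 else 0) = psum E k" for k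
    using sum_box_move[of i' j' "row E" k] i'j' pos by (simp add: psum_def)
  obtain E' where E': "E' \<in> young_diagrams n" "row E' = ?f"
  proof (rule diagram_of_antimono[OF anti])
    show "?f m = 0" if "?N \<le> m" for m
      using that row_eq_0[OF E, of m] i'j' by auto
    show "(\<Sum>m<?N. ?f m) = n"
      using sum[of ?N] psum_diagram[OF E, of ?N] by simp
  qed
  have sum': "psum E' k + (if i' < k \<and> k \<le> j' then 1 else 0) = psum E k" for k
    using sum[of k] unfolding psum_def E'(2) .
  have "box_move E' E"
    unfolding box_move_def using i'j' pos E'(2) by blast
  moreover have "psum D k \<le> psum E' k" for k
  proof (cases "i' < k \<and> k \<le> j'")
    case True
    then show ?thesis
      using strict[of k] sum'[of k] ii' j'j by simp
  next
    case False
    then show ?thesis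
      using le[of k] sum'[of k] by (auto split: if_splits)
  qed
  moreover have "(\<Sum>k<n. psum E' k) < (\<Sum>k<n. psum E k)"
  proof (rule sum_strict_mono_ex1)
    show "\<forall>k\<in>{..<n}. psum E' k \<le> psum E k"
      using sum' by (metis le_add1)
    have "psum D (Suc i') < psum E (Suc i')"
      using strict[of "Suc i'"] ii' i'j by simp
    then have "Suc i' < n"
      using psum_diagram[OF D, of "Suc i'"] psum_diagram[OF E, of "Suc i'"]
      by (metis less_irrefl not_le)
    then show "\<exists>k\<in>{..<n}. psum E' k < psum E k"
      using sum'[of "Suc i'"] i'j' by (intro bexI[of _ "Suc i'"]) (auto simp del: psum_Suc)
  qed simp
  ultimately show thesis
    using E'(1) that by blast
qed

text \<open>Descent from \<open>E\<close> towards \<open>D\<close>: every move of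
  \<open>majorization_step\<close> stays above \<open>D\<close> and lowers the sum of the partial
  sums, so the descent can only end at \<open>D\<close>.\<close>

lemma dominance_if_psum_le:
  assumes "D \<in> young_diagrams n" and "E \<in> young_diagrams n" and "\<And>k. psum D k \<le> psum E k"
  shows "dominance n D E"
  using assms(2,3)
proof (induction "\<Sum>k<n. psum E k" arbitrary: E rule: less_induct)
  case less
  show ?case
  proof (cases "D = E")
    case True
    then show ?thesis by (simp add: dominance_def)
  next
    case False
    then obtain E' where E': "E' \<in> young_diagrams n" "box_move E' E" "\<And>k. psum D k \<le> psum E' k"
      "(\<Sum>k<n. psum E' k) < (\<Sum>k<n. psum E k)"
      using majorization_step[OF assms(1) less.prems(1)] less.prems(2) by metis
    from less.hyps[OF E'(4,1,3)] show ?thesis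
      unfolding dominance_def using E'(1,2) less.prems(1)
      by (auto intro: rtranclp.rtrancl_into_rtrancl)
  qed
qed

text \<open>This is the order reversal of transposition, with the sums of minima as partial sums of
  the transposes. Testing with \<open>k = row E m\<close> makes the sum for \<open>E\<close> exactly
  \<open>m * k\<close> plus the tail from row \<open>m\<close>, while the sum for \<open>D\<close>
  is at most \<open>m * k\<close> plus its own tail. So the tail of \<open>D\<close> is at least
  that of \<open>E\<close>, and both totals are \<open>n\<close>.\<close>

lemma psum_le_if_sum_min_le:
  assumes D: "D \<in> young_diagrams n" and E: "E \<in> young_diagrams n"
    and le: "\<And>k. (\<Sum>i<n. min (row E i) k) \<le> (\<Sum>i<n. min (row D i) k)"
  shows "psum D m \<le> psum E m"
proof (cases "m < n")
  case False
  then show ?thesis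
    using psum_diagram[OF D, of m] psum_diagram[OF E, of m] by simp
next
  case True
  define k where "k = row E m"
  have split: "(\<Sum>i<n. g i) = (\<Sum>i<m. g i) + (\<Sum>i=m..<n. g i)" for g :: "nat \<Rightarrow> nat"
    using True sum.atLeastLessThan_concat[of 0 m n g] by (simp add: atLeast0LessThan)
  have n: "n = psum F m + (\<Sum>i=m..<n. row F i)" if "F \<in> young_diagrams n" for F
    using split[of "row F"] psum_diagram[OF that, of n] by (simp add: psum_def)
  have "(\<Sum>i<n. min (row E i) k) = m * k + (\<Sum>i=m..<n. row E i)"
    unfolding split using row_antimono[OF E] by (simp add: k_def min_absorb2 min_absorb1)
  moreover have "(\<Sum>i<m. min (row D i) k) \<le> (\<Sum>i<m. k)"
    by (rule sum_mono) simp
  moreover have "(\<Sum>i=m..<n. min (row D i) k) \<le> (\<Sum>i=m..<n. row D i)"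
    by (rule sum_mono) simp
  ultimately show ?thesis
    using le[of k] n[OF D] n[OF E] split[of "\<lambda>i. min (row D i) k"] by simp
qed

section \<open>Transposed diagrams and their partial sums\<close>

lemma finite_row_greater: "finite {i. (r::nat) < row D i}"
  by (rule finite_subset[of _ "{..<length D}"]) (auto simp: row_def split: if_splits)

lemma row_transpose_diagram:
  assumes "D \<in> young_diagrams n"
  shows "row (transpose_diagram D) r = card {i. r < row D i}"
proof (cases "r < row D 0")
  case False
  then have "\<not> r < row D i" for i
    using row_antimono[OF assms, of 0 i] by simp
  then show ?thesis
    using False by (simp add: transpose_diagram_def row_def)
qed (simp add: transpose_diagram_def row_def[of "map _ _"])

text \<open>Double counting of the boxes in the first \<open>k\<close> columns of
  \<open>D\<close>.\<close>

lemma psum_transpose_diagram: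
  assumes "D \<in> young_diagrams n"
  shows "psum (transpose_diagram D) k = (\<Sum>i<n. min (row D i) k)"
proof -
  have "psum (transpose_diagram D) k = (\<Sum>r<k. \<Sum>i<n. if r < row D i then 1 else 0)"
    unfolding psum_def row_transpose_diagram[OF assms]
  proof (rule sum.cong[OF refl])
    fix r
    have "i < n" if "r < row D i" for i
      using that row_eq_0[OF assms, of i] by (cases "i < n") simp_all
    then have "{i. r < row D i} = {i \<in> {..<n}. r < row D i}"
      by auto
    then show "card {i. r < row D i} = (\<Sum>i<n. if r < row D i then 1 else 0)"
      by (simp add: sum.If_cases Int_def)
  qed
  also have "\<dots> = (\<Sum>i<n. \<Sum>r<k. if r < row D i then 1 else 0)"
    by (rule sum.swap)
  also have "\<dots> = (\<Sum>i<n. min (row D i) k)"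
  proof (rule sum.cong[OF refl])
    fix i
    have "{..<k} \<inter> {r. r < row D i} = {..<min (row D i) k}"
      by auto
    then show "(\<Sum>r<k. if r < row D i then 1 else 0) = min (row D i) k"
      by (simp add: sum.If_cases)
  qed
  finally show ?thesis .
qed

lemma transpose_diagram_in:
  assumes "D \<in> young_diagrams n"
  shows "transpose_diagram D \<in> young_diagrams n"
proof -
  have "(\<Sum>i<n. min (row D i) (row D 0)) = (\<Sum>i<n. row D i)"
    using row_antimono[OF assms] by (intro sum.cong) (auto simp: min_absorb1)
  then have "psum (transpose_diagram D) (length (transpose_diagram D)) = n"
    using psum_transpose_diagram[OF assms, of "row D 0"] psum_diagram[OF assms, of n]
    by (simp add: transpose_diagram_def psum_def)
  moreover have "sorted_wrt (\<ge>) (transpose_diagram D)"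
    by (auto simp: transpose_diagram_def sorted_wrt_iff_nth_less intro!: card_mono finite_row_greater)
  moreover have "0 \<notin> set (transpose_diagram D)"
    by (auto simp: transpose_diagram_def finite_row_greater card_eq_0_iff)
  ultimately show ?thesis
    by (simp add: young_diagrams_def psum_length)
qed

section \<open>Matrices with entries 0 and 1: the Gale-Ryser criterion\<close>

text \<open>A subset of the plane stands for the positions of the ones in a matrix with entries 0, 1.\<close>

definition zero_one :: "nat list \<Rightarrow> nat list \<Rightarrow> (nat \<times> nat) set \<Rightarrow> bool"
  where "zero_one E D S \<longleftrightarrow> finite S \<and> (\<forall>r. card {s. (r, s) \<in> S} = row E r) \<and>
    (\<forall>s. card {r. (r, s) \<in> S} = row D s)"

text \<open>The cells of the transposed diagram themselves are the ones of the matrix.\<close>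

lemma zero_one_transpose:
  assumes "D \<in> young_diagrams n"
  shows "zero_one (transpose_diagram D) D {(r, s). r < row D s}"
proof -
  have "r < row D 0 \<and> s < n" if "r < row D s" for r s
    using that row_antimono[OF assms, of 0 s] row_eq_0[OF assms, of s]
    by (cases "s < n") simp_all
  then have "{(r, s). r < row D s} \<subseteq> {..<row D 0} \<times> {..<n}"
    by auto
  then have "finite {(r, s). r < row D s}"
    by (rule finite_subset) simp
  moreover have "{r. r < row D s} = {..<row D s}" for s
    by auto
  ultimately show ?thesis
    by (simp add: zero_one_def row_transpose_diagram[OF assms])
qed

text \<open>Row \<open>i\<close> has more ones than row \<open>j\<close>, because \<open>E\<close>
  is still a diagram after the move. By pigeonhole some column has a one in row \<open>i\<close> and
  none in row \<open>j\<close>; shifting this one from \<open>i\<close> to \<open>j\<close> leaves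
  all column sums alone.\<close>

lemma zero_one_box_move:
  assumes E: "E \<in> young_diagrams n" and "box_move E E'" and S: "zero_one E' D S"
  shows "\<exists>S. zero_one E D S"
proof -
  obtain i j where ij: "i < j" "0 < row E' i"
    and row: "row E = (row E')(i := row E' i - 1, j := row E' j + 1)"
    using assms(2) unfolding box_move_def by blast
  have fin: "finite S" and rows: "\<And>r. card {s. (r, s) \<in> S} = row E' r"
    and cols: "\<And>s. card {r. (r, s) \<in> S} = row D s"
    using S by (auto simp: zero_one_def)
  have finr: "finite {s. (r, s) \<in> S}" for r
    using finite_subset[of "{s. (r, s) \<in> S}" "snd ` S"] fin by force
  have finc: "finite {r. (r, s) \<in> S}" for s
    using finite_subset[of "{r. (r, s) \<in> S}" "fst ` S"] fin by force
  have "row E' j < row E' i"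
    using row_antimono[OF E, of i j] ij by (simp add: row)
  then have "\<not> {s. (i, s) \<in> S} \<subseteq> {s. (j, s) \<in> S}"
    using card_mono[OF finr[of j], of "{s. (i, s) \<in> S}"] rows by (metis not_le)
  then obtain t where t: "(i, t) \<in> S" "(j, t) \<notin> S"
    by blast
  let ?S = "insert (j, t) (S - {(i, t)})"
  have "card {s. (r, s) \<in> ?S} = row E r" for r
  proof -
    consider "r = i" | "r = j" | "r \<noteq> i" "r \<noteq> j" by blast
    then show ?thesis
    proof cases
      case 1
      then have "{s. (r, s) \<in> ?S} = {s. (i, s) \<in> S} - {t}"
        using ij by auto
      then show ?thesis
        using 1 t rows[of i] finr ij by (simp add: row)
    next
      case 2
      then have "{s. (r, s) \<in> ?S} = insert t {s. (j, s) \<in> S}"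
        using ij by auto
      then show ?thesis
        using 2 t rows[of j] finr ij by (simp add: row)
    next
      case 3
      then have "{s. (r, s) \<in> ?S} = {s. (r, s) \<in> S}"
        by auto
      then show ?thesis
        using 3 rows by (simp add: row)
    qed
  qed
  moreover have "card {r. (r, s) \<in> ?S} = row D s" for s
  proof (cases "s = t")
    case True
    then have "{r. (r, s) \<in> ?S} = insert j ({r. (r, t) \<in> S} - {i})"
      using ij by auto
    moreover have "0 < card {r. (r, t) \<in> S}"
      using finc t(1) by (auto simp: card_gt_0_iff)
    ultimately show ?thesis
      using True t cols[of t] finc by (simp add: card_insert_if)
  next
    case False
    then have "{r. (r, s) \<in> ?S} = {r. (r, s) \<in> S}"
      by auto
    then show ?thesis
      using cols by simp
  qed
  ultimately have "zero_one E D ?S"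
    using fin by (simp add: zero_one_def)
  then show ?thesis ..
qed

lemma zero_one_if_dominance:
  assumes "dominance n E (transpose_diagram D)" and "D \<in> young_diagrams n"
  shows "\<exists>S. zero_one E D S"
  using assms(1) unfolding dominance_def
proof (induction rule: converse_rtranclp_induct)
  case base
  then show ?case using zero_one_transpose[OF assms(2)] by blast
next
  case (step E E')
  then show ?case using zero_one_box_move by blast
qed

text \<open>The ones in the first \<open>k\<close> rows are counted by columns; a column contributes
  at most its own sum and at most \<open>k\<close>. This is the easy half of Gale-Ryser.\<close>

lemma zero_one_bounds:
  assumes S: "zero_one E D S" and D: "D \<in> young_diagrams n"
  shows "psum E k = (\<Sum>s<n. card {r. r < k \<and> (r, s) \<in> S})"
    and "card {r. r < k \<and> (r, s) \<in> S} \<le> min (row D s) k"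
proof -
  have fin: "finite S" and rows: "\<And>r. card {s. (r, s) \<in> S} = row E r"
    and cols: "\<And>s. card {r. (r, s) \<in> S} = row D s"
    using S by (auto simp: zero_one_def)
  have finc: "finite {r. (r, s) \<in> S}" for s
    using finite_subset[of "{r. (r, s) \<in> S}" "fst ` S"] fin by force
  have "s < n" if "(r, s) \<in> S" for r s
  proof (rule ccontr)
    assume "\<not> s < n"
    then have "card {r. (r, s) \<in> S} = 0"
      using cols row_eq_0[OF D] by simp
    then show False
      using that finc by auto
  qed
  then have "row E r = (\<Sum>s<n. if (r, s) \<in> S then 1 else 0)" for r
    unfolding rows[symmetric] by (subst sum.If_cases) (auto intro!: arg_cong[of _ _ card])
  then have "psum E k = (\<Sum>r<k. \<Sum>s<n. if (r, s) \<in> S then 1 else 0)"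
    by (simp add: psum_def)
  also have "\<dots> = (\<Sum>s<n. \<Sum>r<k. if (r, s) \<in> S then 1 else 0)"
    by (rule sum.swap)
  also have "\<dots> = (\<Sum>s<n. card {r. r < k \<and> (r, s) \<in> S})"
    by (intro sum.cong refl, subst sum.If_cases) (auto intro!: arg_cong[of _ _ card])
  finally show "psum E k = (\<Sum>s<n. card {r. r < k \<and> (r, s) \<in> S})" .
  have "card {r. r < k \<and> (r, s) \<in> S} \<le> card {r. (r, s) \<in> S}"
    using finc by (intro card_mono) auto
  moreover have "card {r. r < k \<and> (r, s) \<in> S} \<le> card {..<k}"
    by (intro card_mono) auto
  ultimately show "card {r. r < k \<and> (r, s) \<in> S} \<le> min (row D s) k"
    using cols by simp
qed

lemma psum_le_if_zero_one:
  assumes "zero_one E D S" and "D \<in> young_diagrams n"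
  shows "psum E k \<le> (\<Sum>s<n. min (row D s) k)"
  using zero_one_bounds[OF assms] by (simp add: sum_mono)

lemma dominance_iff_zero_one:
  assumes D: "D \<in> young_diagrams n" and E: "E \<in> young_diagrams n"
  shows "dominance n E (transpose_diagram D) \<longleftrightarrow> (\<exists>S. zero_one E D S)"
  using zero_one_if_dominance[OF _ D] dominance_if_psum_le[OF E transpose_diagram_in[OF D]]
    psum_le_if_zero_one[OF _ D] psum_transpose_diagram[OF D] by metis

text \<open>All inequalities behind \<open>psum_le_if_zero_one\<close> are equalities here.\<close>

lemma zero_one_transpose_unique:
  assumes S: "zero_one (transpose_diagram D) D S" and D: "D \<in> young_diagrams n"
  shows "S = {(r, s). r < row D s}"
proof -
  have "(\<Sum>s<n. card {r. r < k \<and> (r, s) \<in> S}) = (\<Sum>s<n. min (row D s) k)" for k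
    using zero_one_bounds(1)[OF S D, of k] psum_transpose_diagram[OF D, of k] by simp
  \<comment> \<open>Termwise bounded sums with equal totals agree term by term.\<close>
  then have eq: "card {r. r < k \<and> (r, s) \<in> S} = min (row D s) k" if "s < n" for k s
    using sum_mono_inv[of "\<lambda>s. card {r. r < k \<and> (r, s) \<in> S}" "{..<n}" "\<lambda>s. min (row D s) k" s]
      zero_one_bounds(2)[OF S D] that by simp
  have eq: "card {r. r < k \<and> (r, s) \<in> S} = min (row D s) k" for k s
  proof (cases "s < n")
    case False
    then show ?thesis
      using zero_one_bounds(2)[OF S D, of k s] row_eq_0[OF D, of s] by simp
  qed (rule eq)
  have "(r, s) \<in> S \<longleftrightarrow> r < row D s" for r s
  proof -
    \<comment> \<open>Passing from \<open>r\<close> to \<open>Suc r\<close> raises the count exactly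
      if \<open>(r, s)\<close> is in \<open>S\<close>, and raises the minimum exactly if
      \<open>r < row D s\<close>.\<close>
    have "{q. q < Suc r \<and> (q, s) \<in> S} =
        (if (r, s) \<in> S then insert r {q. q < r \<and> (q, s) \<in> S} else {q. q < r \<and> (q, s) \<in> S})"
      by (auto simp: less_Suc_eq)
    then have "card {q. q < Suc r \<and> (q, s) \<in> S} =
        card {q. q < r \<and> (q, s) \<in> S} + (if (r, s) \<in> S then 1 else 0)"
      by simp
    then show ?thesis
      unfolding eq by (auto split: if_splits)
  qed
  then show ?thesis by auto
qed

section \<open>Words\<close>

text \<open>
  The cosets \<open>S\<^sub>D x\<close> of the Young subgroup correspond to the words \<open>w\<close> on \<open>{1..n}\<close> in which the
  letter \<open>r\<close> occurs \<open>row D r\<close> times. The value 0 outside \<open>{1..n}\<close> makes equality of words an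
  equality of functions.
\<close>

definition colour :: "nat list \<Rightarrow> nat \<Rightarrow> nat"
  where "colour D p =
    (if p \<in> {1..sum_list D} then LEAST r. p \<le> sum_list (take (Suc r) D) else 0)"

definition words :: "nat \<Rightarrow> nat list \<Rightarrow> (nat \<Rightarrow> nat) set"
  where "words n D =
    {w. (\<forall>p. p \<notin> {1..n} \<longrightarrow> w p = 0) \<and> (\<forall>r. card {p \<in> {1..n}. w p = r} = row D r)}"

lemma words_outside: "w \<in> words n D \<Longrightarrow> p \<notin> {1..n} \<Longrightarrow> w p = 0"
  unfolding words_def by blast

lemma card_words: "w \<in> words n D \<Longrightarrow> card {p \<in> {1..n}. w p = r} = row D r"
  unfolding words_def by blast

lemma sum_list_take_mono:
  fixes D :: "nat list"
  assumes "i \<le> j"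
  shows "sum_list (take i D) \<le> sum_list (take j D)"
proof -
  have "take j D = take i D @ take (j - i) (drop i D)"
    using assms take_add[of i "j - i" D] by simp
  then show ?thesis
    by (metis le_add1 sum_list_append)
qed

lemma sum_list_take_Suc: "sum_list (take (Suc r) D) = sum_list (take r D) + row D r"
  by (simp add: row_def take_Suc_conv_app_nth)

lemma mem_block_colour:
  assumes "sum_list D = n" and "p \<in> {1..n}"
  shows "colour D p < length D" and "p \<in> block D (colour D p)"
proof -
  have c: "colour D p = (LEAST r. p \<le> sum_list (take (Suc r) D))"
    using assms by (simp add: colour_def)
  have "p \<le> sum_list (take (Suc (length D - 1)) D)"
    using assms by (cases D) auto
  then have up: "p \<le> sum_list (take (Suc (colour D p)) D)" and "colour D p \<le> length D - 1"
    unfolding c by (rule LeastI, rule Least_le)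
  moreover have "D \<noteq> []"
    using assms by auto
  ultimately show "colour D p < length D"
    by (cases D) auto
  have "sum_list (take (colour D p) D) < p"
  proof (cases "colour D p")
    case 0
    then show ?thesis using assms by simp
  next
    case (Suc r)
    then show ?thesis
      using not_less_Least[of r "\<lambda>r. p \<le> sum_list (take (Suc r) D)"] c by simp
  qed
  then show "p \<in> block D (colour D p)"
    using up by (simp add: block_def)
qed

lemma colour_eq_iff:
  assumes "sum_list D = n" and "r < length D" and "p \<in> {1..n}"
  shows "colour D p = r \<longleftrightarrow> p \<in> block D r"
proof
  assume p: "p \<in> block D r"
  have "(LEAST r. p \<le> sum_list (take (Suc r) D)) = r"
  proof (rule Least_equality)
    show "p \<le> sum_list (take (Suc r) D)"
      using p by (simp add: block_def)
    show "r \<le> s" if "p \<le> sum_list (take (Suc s) D)" for s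
    proof (rule ccontr)
      assume "\<not> r \<le> s"
      then have "sum_list (take (Suc s) D) \<le> sum_list (take r D)"
        by (intro sum_list_take_mono) simp
      then show False
        using p that by (simp add: block_def)
    qed
  qed
  then show "colour D p = r"
    using assms by (simp add: colour_def)
qed (use mem_block_colour[OF assms(1,3)] in simp)

lemma block_subset:
  assumes "sum_list D = n"
  shows "block D r \<subseteq> {1..n}"
  using sum_list_take_mono[of "Suc r" "max (Suc r) (length D)" D] assms
  by (auto simp: block_def)

lemma block_eq_colour:
  assumes "sum_list D = n" and "r < length D"
  shows "block D r = {p \<in> {1..n}. colour D p = r}"
  using colour_eq_iff[OF assms] block_subset[OF assms(1), of r] by blast

lemma colour_in_words:
  assumes "sum_list D = n"
  shows "colour D \<in> words n D"
proof -
  have "card {p \<in> {1..n}. colour D p = r} = row D r" for r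
  proof (cases "r < length D")
    case True
    then show ?thesis
      unfolding block_eq_colour[OF assms True, symmetric]
      using sum_list_take_Suc[of r D] by (simp add: block_def)
  next
    case False
    then have "{p \<in> {1..n}. colour D p = r} = {}"
      using mem_block_colour(1)[OF assms] by auto
    then show ?thesis
      using False by (simp add: row_def)
  qed
  then show ?thesis
    using assms by (simp add: words_def colour_def)
qed

text \<open>The Young subgroup becomes the stabiliser of the single word \<open>colour D\<close>,
  which is what identifies its cosets with words.\<close>

lemma mem_young_subgroup_iff:
  assumes "sum_list D = n"
  shows "h \<in> young_subgroup n D \<longleftrightarrow> h permutes {1..n} \<and> colour D \<circ> h = colour D"
proof (cases "h permutes {1..n}")
  case h: True
  show ?thesis
  proof
    assume l: "h \<in> young_subgroup n D"
    have "colour D (h p) = colour D p" for p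
    proof (cases "p \<in> {1..n}")
      case True
      then have "h p \<in> block D (colour D p)"
        using mem_block_colour[OF assms True] l by (auto simp: young_subgroup_def)
      then show ?thesis
        using colour_eq_iff[OF assms] mem_block_colour[OF assms True] True
        by (simp only: permutes_in_image[OF h])
    next
      case False
      then show ?thesis
        using h by (metis permutes_def)
    qed
    then show "h permutes {1..n} \<and> colour D \<circ> h = colour D"
      using h by auto
  next
    assume r: "h permutes {1..n} \<and> colour D \<circ> h = colour D"
    have "h ` block D r = block D r" if "r < length D" for r
    proof (rule card_subset_eq)
      have "colour D (h p) = colour D p" for p
        using r by (metis comp_apply)
      then show "h ` block D r \<subseteq> block D r"
        unfolding block_eq_colour[OF assms that]
        by (auto simp only: permutes_in_image[OF h] mem_Collect_eq image_iff)
      show "card (h ` block D r) = card (block D r)"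
        by (intro card_image permutes_inj_on[OF h])
    qed (simp add: block_def)
    then show "h \<in> young_subgroup n D"
      using h by (simp add: young_subgroup_def sym_group_carrier)
  qed
qed (simp add: young_subgroup_def sym_group_carrier)

text \<open>Transitivity of the symmetric group on words: equal letter counts mean equal multisets
  of values on \<open>{1..n}\<close>.\<close>

lemma words_conjugate:
  assumes v: "v \<in> words n D" and w: "w \<in> words n D"
  obtains x where "x permutes {1..n}" and "w = v \<circ> x"
proof -
  have "count (image_mset w (mset_set {1..n})) r = count (image_mset v (mset_set {1..n})) r" for r
    by (simp only: count_image_mset_eq_card_vimage[OF finite_atLeastAtMost] card_words[OF v]
        card_words[OF w])
  then have "image_mset w (mset_set {1..n}) = image_mset v (mset_set {1..n})"
    by (rule multiset_eqI)
  then obtain x where x: "x permutes {1..n}" "\<forall>p\<in>{1..n}. w p = v (x p)"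
    using image_mset_eq_implies_permutes[of "{1..n}" w v] by blast
  have "w p = v (x p)" for p
  proof (cases "p \<in> {1..n}")
    case False
    then have "x p = p"
      using x(1) by (simp add: permutes_def)
    then show ?thesis
      using words_outside[OF v False] words_outside[OF w False] by simp
  qed (use x(2) in simp)
  then show thesis
    using that[OF x(1)] by (simp add: fun_eq_iff)
qed

lemma bij_betw_permutes_filter:
  assumes "x permutes A"
  shows "bij_betw x {p \<in> A. P (x p)} {p \<in> A. P p}"
proof (rule bij_betw_imageI[OF permutes_inj_on[OF assms]])
  have "q \<in> x ` {p \<in> A. P (x p)}" if "q \<in> A" "P q" for q
    using that permutes_inverses(1)[OF assms, of q] permutes_in_image[OF permutes_inv[OF assms], of q]
    by (intro image_eqI[of _ _ "inv' x q"]) auto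
  then show "x ` {p \<in> A. P (x p)} = {p \<in> A. P p}"
    using permutes_in_image[OF assms] by auto
qed

lemma words_comp_iff:
  assumes x: "x permutes {1..n}"
  shows "w \<circ> x \<in> words n D \<longleftrightarrow> w \<in> words n D"
proof -
  have *: "w \<circ> x \<in> words n D" if x: "x permutes {1..n}" and w: "w \<in> words n D" for x w
  proof -
    have "w (x p) = 0" if "p \<notin> {1..n}" for p
    proof -
      have "x p = p"
        using x that by (simp add: permutes_def)
      then show ?thesis
        using words_outside[OF w that] by simp
    qed
    moreover have "card {p \<in> {1..n}. w (x p) = r} = row D r" for r
      using bij_betw_same_card[OF bij_betw_permutes_filter[OF x, of "\<lambda>q. w q = r"]]
        card_words[OF w, of r] by (simp only:)

    ultimately show ?thesis
      by (simp add: words_def)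
  qed
  show ?thesis
    using *[OF x] *[OF permutes_inv[OF x], of "w \<circ> x"] permutes_surj[OF x]
    by (auto simp: comp_assoc permutes_inv_o[OF x] simp del: One_nat_def)
qed

section \<open>Injectivity of the operator moving one letter\<close>

text \<open>A raising or lowering operator of the \<open>sl_2\<close> belonging to the letters
  \<open>i\<close> and \<open>j\<close>. It acts on functions on arbitrary words rather than on
  words of one content, so that both directions can be composed.\<close>

definition move_letter ::
  "nat set \<Rightarrow> nat \<Rightarrow> nat \<Rightarrow> ((nat \<Rightarrow> nat) \<Rightarrow> complex) \<Rightarrow> (nat \<Rightarrow> nat) \<Rightarrow> complex"
  where "move_letter A i j \<phi> w = (\<Sum>p\<in>{p \<in> A. w p = j}. \<phi> (w(p := i)))"

text \<open>Change one letter, then change one back. If the same position is used twice, the word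
  returns to \<open>u\<close>, once for each occurrence of the first letter. Two different positions
  give the same double sum in either order, so only the letter counts survive in the
  difference.\<close>

lemma move_letter_commutator:
  assumes "finite A" and "i \<noteq> j"
  shows "move_letter A j i (move_letter A i j \<phi>) u + of_nat (card {p \<in> A. u p = j}) * \<phi> u =
    move_letter A i j (move_letter A j i \<phi>) u + of_nat (card {p \<in> A. u p = i}) * \<phi> u"
proof -
  have *: "move_letter A b a (move_letter A a b \<phi>) u =
      (\<Sum>p\<in>{p \<in> A. u p = a}. \<phi> u + (\<Sum>q\<in>{q \<in> A. u q = b}. \<phi> (u(p := b, q := a))))"
    if "a \<noteq> b" for a b
    unfolding move_letter_def
  proof (rule sum.cong[OF refl])
    fix p assume p: "p \<in> {p \<in> A. u p = a}"
    then have "{q \<in> A. (u(p := b)) q = b} = insert p {q \<in> A. u q = b}"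
      by auto
    moreover have "p \<notin> {q \<in> A. u q = b}" and "u(p := a) = u"
      using p that by auto
    ultimately show "(\<Sum>q\<in>{q \<in> A. (u(p := b)) q = b}. \<phi> (u(p := b, q := a))) =
        \<phi> u + (\<Sum>q\<in>{q \<in> A. u q = b}. \<phi> (u(p := b, q := a)))"
      using assms(1) by simp
  qed
  have "(\<Sum>p\<in>{p \<in> A. u p = i}. \<Sum>q\<in>{q \<in> A. u q = j}. \<phi> (u(p := j, q := i))) =
      (\<Sum>q\<in>{q \<in> A. u q = j}. \<Sum>p\<in>{p \<in> A. u p = i}. \<phi> (u(p := j, q := i)))"
    by (rule sum.swap)
  also have "\<dots> = (\<Sum>q\<in>{q \<in> A. u q = j}. \<Sum>p\<in>{p \<in> A. u p = i}. \<phi> (u(q := i, p := j)))"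
    using assms(2) by (intro sum.cong refl arg_cong[of _ _ \<phi>]) (auto simp: fun_upd_twist)
  finally show ?thesis
    using *[of i j] *[of j i] assms(2) by (simp add: sum.distrib algebra_simps)
qed

text \<open>Both sides sum over the pairs of words that differ at one marked position, with
  \<open>j\<close> there in one word and \<open>i\<close> in the other; the sum is indexed from
  either end. Closure of \<open>W\<close> keeps both ends inside.\<close>

lemma move_letter_adjoint:
  assumes "finite W" and "finite A"
    and W: "\<And>w p. w \<in> W \<Longrightarrow> p \<in> A \<Longrightarrow> w(p := i) \<in> W \<and> w(p := j) \<in> W"
  shows "(\<Sum>w\<in>W. move_letter A i j \<phi> w * cnj (\<chi> w)) =
    (\<Sum>u\<in>W. \<phi> u * cnj (move_letter A j i \<chi> u))"
proof -
  have "(\<Sum>w\<in>W. move_letter A i j \<phi> w * cnj (\<chi> w)) =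
      (\<Sum>(w, p)\<in>(SIGMA w:W. {p \<in> A. w p = j}). \<phi> (w(p := i)) * cnj (\<chi> w))"
    using assms(1,2) by (simp add: move_letter_def sum.Sigma sum_distrib_right)
  also have "\<dots> = (\<Sum>(u, p)\<in>(SIGMA u:W. {p \<in> A. u p = i}). \<phi> u * cnj (\<chi> (u(p := j))))"
    using W
    by (intro sum.reindex_bij_witness[of _ "\<lambda>(u, p). (u(p := j), p)" "\<lambda>(w, p). (w(p := i), p)"])
      auto
  also have "\<dots> = (\<Sum>u\<in>W. \<phi> u * cnj (move_letter A j i \<chi> u))"
    using assms(1,2) by (simp add: move_letter_def sum.Sigma sum_distrib_left)
  finally show ?thesis .
qed

text \<open>
  For \<open>U = move_letter A i j\<close> and its adjoint \<open>L\<close>, the commutator formula gives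
  \<open>\<parallel>U \<phi>\<parallel>\<^sup>2 = \<parallel>L \<phi>\<parallel>\<^sup>2 + (a - b) \<parallel>\<phi>\<parallel>\<^sup>2\<close>.
\<close>

lemma move_letter_injective:
  assumes "finite W" and "finite A" and "i \<noteq> j" and "b < a"
    and W: "\<And>w p. w \<in> W \<Longrightarrow> p \<in> A \<Longrightarrow> w(p := i) \<in> W \<and> w(p := j) \<in> W"
    and supp: "\<And>w. w \<in> W \<Longrightarrow> \<phi> w \<noteq> 0 \<Longrightarrow>
      card {p \<in> A. w p = i} = a \<and> card {p \<in> A. w p = j} = b"
    and zero: "\<And>w. w \<in> W \<Longrightarrow> move_letter A i j \<phi> w = 0"
    and "w \<in> W"
  shows "\<phi> w = 0"
proof -
  let ?U = "move_letter A i j" and ?L = "move_letter A j i"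
  have sq: "z * cnj z = of_real ((cmod z)\<^sup>2)" for z
    by (rule complex_norm_square[symmetric])
  have "?L (?U \<phi>) u = 0" if "u \<in> W" for u
    using zero W that by (simp add: move_letter_def[of A j i])
  \<comment> \<open>Where \<open>\<phi> u\<close> is nonzero the letter counts are \<open>a\<close>
    and \<open>b\<close>; elsewhere the terms with the counts vanish, so the constants may be used
    for every \<open>u\<close>.\<close>
  then have comm: "?U (?L \<phi>) u + (of_nat a - of_nat b) * \<phi> u = 0" if "u \<in> W" for u
    using move_letter_commutator[OF assms(2,3), of \<phi> u] supp[OF that] that
    by (cases "\<phi> u = 0") (auto simp: algebra_simps)
  have "(\<Sum>u\<in>W. ?U (?L \<phi>) u * cnj (\<phi> u)) = (\<Sum>u\<in>W. ?L \<phi> u * cnj (?L \<phi> u))"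
    using assms(1,2) W by (rule move_letter_adjoint)
  moreover have "(\<Sum>u\<in>W. ?U (?L \<phi>) u * cnj (\<phi> u)) + (of_nat a - of_nat b) * (\<Sum>u\<in>W. \<phi> u * cnj (\<phi> u))
      = (\<Sum>u\<in>W. (?U (?L \<phi>) u + (of_nat a - of_nat b) * \<phi> u) * cnj (\<phi> u))"
    by (simp only: distrib_right sum.distrib sum_distrib_left mult.assoc)
  ultimately have "(\<Sum>u\<in>W. ?L \<phi> u * cnj (?L \<phi> u)) + (of_nat a - of_nat b) * (\<Sum>u\<in>W. \<phi> u * cnj (\<phi> u)) = 0"
    using comm by simp
  then have "complex_of_real ((\<Sum>u\<in>W. (cmod (?L \<phi> u))\<^sup>2) + (real a - real b) * (\<Sum>u\<in>W. (cmod (\<phi> u))\<^sup>2)) = 0"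
    unfolding sq by simp
  then have "(\<Sum>u\<in>W. (cmod (?L \<phi> u))\<^sup>2) + (real a - real b) * (\<Sum>u\<in>W. (cmod (\<phi> u))\<^sup>2) = 0"
    unfolding of_real_eq_0_iff .
  moreover have "0 \<le> (\<Sum>u\<in>W. (cmod (?L \<phi> u))\<^sup>2)" and nn: "0 \<le> (\<Sum>u\<in>W. (cmod (\<phi> u))\<^sup>2)"
    by (simp_all add: sum_nonneg)
  ultimately have "(\<Sum>u\<in>W. (cmod (\<phi> u))\<^sup>2) = 0"
    using \<open>b < a\<close> mult_pos_pos[of "real a - real b" "\<Sum>u\<in>W. (cmod (\<phi> u))\<^sup>2"]
    by fastforce
  then show ?thesis
    using assms(1) \<open>w \<in> W\<close> by (simp add: sum_nonneg_eq_0_iff)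
qed

section \<open>Intertwiners\<close>

lemma clinear_on_zero:
  assumes "clinear_on V f" and "0 \<in> V"
  shows "f 0 = 0"
proof -
  have "f (0 *\<^sub>C 0) = 0 *\<^sub>C f 0"
    using assms unfolding clinear_on_def by blast
  then show ?thesis by simp
qed

lemma clinear_on_sum:
  assumes f: "clinear_on V f" and V: "complex_vector.subspace V"
    and "\<And>i. i \<in> I \<Longrightarrow> v i \<in> V"
  shows "f (\<Sum>i\<in>I. c i *\<^sub>C v i) = (\<Sum>i\<in>I. c i *\<^sub>C f (v i))"
  using assms(3)
proof (induction I rule: infinite_finite_induct)
  case (insert i I)
  then have "c i *\<^sub>C v i \<in> V" and "(\<Sum>i\<in>I. c i *\<^sub>C v i) \<in> V"
    using complex_vector.subspace_scale[OF V]
    by (auto intro!: complex_vector.subspace_sum[OF V])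
  then show ?case
    using insert f unfolding clinear_on_def by simp
qed (simp_all add: clinear_on_zero[OF f complex_vector.subspace_0[OF V]])

lemma clinear_on_inj_onI:
  assumes f: "clinear_on V f" and V: "complex_vector.subspace V"
    and ker: "\<And>v. v \<in> V \<Longrightarrow> f v = 0 \<Longrightarrow> v = 0"
  shows "inj_on f V"
proof (rule inj_onI)
  fix u v assume uv: "u \<in> V" "v \<in> V" "f u = f v"
  have mv: "(- 1) *\<^sub>C v \<in> V"
    by (rule complex_vector.subspace_scale[OF V uv(2)])
  have "f (u + (- 1) *\<^sub>C v) = f u + (- 1) *\<^sub>C f v"
    using f uv mv unfolding clinear_on_def by metis
  then have "f (u + (- 1) *\<^sub>C v) = 0"
    using uv(3) by simp
  then have "u + (- 1) *\<^sub>C v = 0"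
    using ker complex_vector.subspace_add[OF V uv(1) mv] by blast
  then show "u = v" by simp
qed

text \<open>A basis of \<open>V\<close> extends \<open>f\<close> from \<open>V\<close> to a linear
  map \<open>g\<close> on the whole type. A vector of \<open>V\<close> outside the image could be
  added to the independent image of the basis, giving too many independent vectors in
  \<open>V\<close>.\<close>

lemma clinear_on_inj_on_surj:
  fixes V :: "'v::complex_vector set"
  assumes f: "clinear_on V f" and V: "complex_vector.subspace V" "fin_dim V"
    and inj: "inj_on f V" and im: "f ` V \<subseteq> V"
  shows "f ` V = V"
proof (rule ccontr)
  assume "f ` V \<noteq> V"
  then obtain w where w: "w \<in> V" "w \<notin> f ` V"
    using im by blast
  obtain B where B: "B \<subseteq> V" "complex_vector.independent B" "V \<subseteq> complex_vector.span B"
    using complex_vector.maximal_independent_subset[of V] by blast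
  have span: "complex_vector.span B = V"
    using B complex_vector.span_minimal[OF B(1) V(1)] by blast
  obtain C where "finite C" "V \<subseteq> complex_vector.span C"
    using V(2) by (auto simp: fin_dim_def)
  then have fin: "finite B"
    using complex_vector.independent_span_bound[OF _ B(2)] B(1) by blast
  interpret vector_space_pair
    "scaleC :: complex \<Rightarrow> 'v \<Rightarrow> 'v" "scaleC :: complex \<Rightarrow> 'v \<Rightarrow> 'v" ..
  define g where "g = construct B f"
  have lin: "Vector_Spaces.linear (*\<^sub>C) (*\<^sub>C) g"
    unfolding g_def by (rule linear_construct[OF B(2)])
  interpret g: Vector_Spaces.linear "scaleC :: complex \<Rightarrow> 'v \<Rightarrow> 'v" "scaleC :: complex \<Rightarrow> 'v \<Rightarrow> 'v" g
    by (rule lin)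
  have eq: "g v = f v" if "v \<in> V" for v
  proof -
    have "complex_vector.subspace {v \<in> V. g v = f v}"
      using f V(1) clinear_on_zero[OF f complex_vector.subspace_0[OF V(1)]]
      by (intro complex_vector.subspaceI)
        (auto simp: clinear_on_def g.zero g.add g.scale complex_vector.subspace_0
          complex_vector.subspace_add complex_vector.subspace_scale)
    moreover have "B \<subseteq> {v \<in> V. g v = f v}"
      using B(1) construct_basis[OF B(2)] by (auto simp: g_def)
    ultimately have "complex_vector.span B \<subseteq> {v \<in> V. g v = f v}"
      by (intro complex_vector.span_minimal)
    then show ?thesis
      using span that by blast
  qed
  have "inj_on g (complex_vector.span B)"
    using inj eq unfolding span by (simp add: inj_on_def)
  then have indep: "complex_vector.independent (g ` B)"
    using linear_independent_injective_image[OF lin B(2)] by blast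
  have "complex_vector.span (g ` B) = f ` V"
    using g.span_image[of B] eq unfolding span by force
  then have "complex_vector.independent (insert w (g ` B))" and "w \<notin> g ` B"
    using w(2) indep complex_vector.independent_insertI complex_vector.span_base[of w "g ` B"]
    by blast+
  moreover have "insert w (g ` B) \<subseteq> complex_vector.span B"
    unfolding span using w(1) B(1) eq im by auto
  ultimately have "card (insert w (g ` B)) \<le> card B"
    using complex_vector.independent_span_bound[OF fin] by blast
  moreover have "card (g ` B) = card B"
    using inj B(1) eq by (intro card_image) (auto simp: inj_on_def subset_iff)
  ultimately show False
    using \<open>w \<notin> g ` B\<close> fin by simp
qed

lemma sum_fun_apply: "(\<Sum>i\<in>I. f i) x = (\<Sum>i\<in>I. f i x)"
  by (induction I rule: infinite_finite_induct) auto

section \<open>Composition of intertwiners, embeddings and proper subrepresentations\<close>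

lemma act_closed:
  assumes "is_rep G \<pi>" and "g \<in> carrier G" and "v \<in> vspace \<pi>"
  shows "act \<pi> g v \<in> vspace \<pi>"
  using assms unfolding is_rep_def by blast

lemma intertwinersD:
  assumes "f \<in> intertwiners G \<pi> \<tau>"
  shows "\<And>v. v \<notin> vspace \<pi> \<Longrightarrow> f v = 0" and "\<And>v. v \<in> vspace \<pi> \<Longrightarrow> f v \<in> vspace \<tau>"
    and "clinear_on (vspace \<pi>) f"
    and "\<And>g v. g \<in> carrier G \<Longrightarrow> v \<in> vspace \<pi> \<Longrightarrow> f (act \<pi> g v) = act \<tau> g (f v)"
  using assms by (auto simp: intertwiners_def)

lemma intertwiners_comp:
  assumes "f \<in> intertwiners G \<pi> \<tau>" and "g \<in> intertwiners G \<tau> \<sigma>" and "is_rep G \<tau>"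
  shows "g \<circ> f \<in> intertwiners G \<pi> \<sigma>"
proof -
  have "0 \<in> vspace \<tau>"
    using assms(3) complex_vector.subspace_0 by (auto simp: is_rep_def)
  \<comment> \<open>Outside \<open>vspace \<pi>\<close> the composite takes the value
    \<open>g 0\<close>, which the normalisation of intertwiners requires to be 0.\<close>
  then have "g 0 = 0"
    by (rule clinear_on_zero[OF intertwinersD(3)[OF assms(2)]])
  then show ?thesis
    using assms(1,2) by (auto simp: intertwiners_def clinear_on_def image_subset_iff)
qed

text \<open>Properness is left out so that the relation is reflexive and transitive and can follow a
  chain of box moves.\<close>

definition rep_embeds ::
  "('g, 'm) monoid_scheme \<Rightarrow> ('g, 'v::complex_vector) rep \<Rightarrow> ('g, 'w::complex_vector) rep \<Rightarrow> bool"
  where "rep_embeds G \<pi> \<tau> \<longleftrightarrow> (\<exists>f\<in>intertwiners G \<pi> \<tau>. inj_on f (vspace \<pi>))"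

lemma rep_embeds_refl:
  assumes "is_rep G \<pi>"
  shows "rep_embeds G \<pi> \<pi>"
proof -
  have sub: "complex_vector.subspace (vspace \<pi>)"
    and im: "\<And>g v. g \<in> carrier G \<Longrightarrow> v \<in> vspace \<pi> \<Longrightarrow> act \<pi> g v \<in> vspace \<pi>"
    using assms by (auto simp: is_rep_def)
  \<comment> \<open>The identity is cut off outside \<open>vspace \<pi>\<close> to meet the
    normalisation of intertwiners.\<close>
  have "(\<lambda>v. if v \<in> vspace \<pi> then v else 0) \<in> intertwiners G \<pi> \<pi>"
    using im complex_vector.subspace_add[OF sub] complex_vector.subspace_scale[OF sub]
    by (auto simp: intertwiners_def clinear_on_def)
  then show ?thesis
    unfolding rep_embeds_def by (rule bexI[rotated]) (simp add: inj_on_def)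
qed

lemma rep_embeds_trans:
  assumes "rep_embeds G \<pi> \<tau>" and "rep_embeds G \<tau> \<sigma>" and "is_rep G \<tau>"
  shows "rep_embeds G \<pi> \<sigma>"
proof -
  obtain f g where f: "f \<in> intertwiners G \<pi> \<tau>" "inj_on f (vspace \<pi>)"
    and g: "g \<in> intertwiners G \<tau> \<sigma>" "inj_on g (vspace \<tau>)"
    using assms unfolding rep_embeds_def by blast
  have "inj_on (g \<circ> f) (vspace \<pi>)"
    using intertwinersD(2)[OF f(1)] by (intro comp_inj_on f(2) inj_on_subset[OF g(2)]) auto
  then show ?thesis
    unfolding rep_embeds_def using intertwiners_comp[OF f(1) g(1) assms(3)] by blast
qed

lemma rep_embeds_inverse:
  assumes f: "f \<in> intertwiners G \<pi> \<tau>" and inj: "inj_on f (vspace \<pi>)"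
    and surj: "f ` vspace \<pi> = vspace \<tau>" and "is_rep G \<pi>"
  shows "rep_embeds G \<tau> \<pi>"
proof -
  let ?V = "vspace \<pi>"
  have sub: "complex_vector.subspace ?V"
    and im: "\<And>g v. g \<in> carrier G \<Longrightarrow> v \<in> ?V \<Longrightarrow> act \<pi> g v \<in> ?V"
    using assms(4) by (auto simp: is_rep_def)
  define h where "h w = (if w \<in> vspace \<tau> then inv_into ?V f w else 0)" for w
  have h: "h (f v) = v" if "v \<in> ?V" for v
    using that surj inj by (auto simp: h_def)
  have eqs: "f u + f v = f (u + v)" "c *\<^sub>C f v = f (c *\<^sub>C v)" if "u \<in> ?V" "v \<in> ?V" for u v c
    using intertwinersD(3)[OF f] that by (auto simp: clinear_on_def)
  have closed: "u + v \<in> ?V" "c *\<^sub>C v \<in> ?V" if "u \<in> ?V" "v \<in> ?V" for u v c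
    using that complex_vector.subspace_add[OF sub] complex_vector.subspace_scale[OF sub] by auto
  have "h \<in> intertwiners G \<tau> \<pi>"
    unfolding intertwiners_def clinear_on_def surj[symmetric]
    by (auto simp: h eqs closed im intertwinersD(4)[OF f, symmetric])
      (simp add: h_def surj)
  moreover have "inj_on h (vspace \<tau>)"
    unfolding surj[symmetric] by (auto simp: inj_on_def h)
  ultimately show ?thesis
    unfolding rep_embeds_def by blast
qed

lemma iso_proper_subrep_iff:
  assumes \<pi>: "is_rep G \<pi>" and \<tau>: "is_rep G \<tau>"
  shows "iso_proper_subrep G \<pi> \<tau> \<longleftrightarrow>
    (\<exists>f\<in>intertwiners G \<pi> \<tau>. inj_on f (vspace \<pi>) \<and> f ` vspace \<pi> \<noteq> vspace \<tau>)"
proof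
  assume "iso_proper_subrep G \<pi> \<tau>"
  then obtain W f where W: "W \<subseteq> vspace \<tau>" "W \<noteq> vspace \<tau>"
    and f: "f \<in> intertwiners G \<pi> (\<tau>\<lparr>vspace := W\<rparr>)" "bij_betw f (vspace \<pi>) W"
    by (auto simp: iso_proper_subrep_def invariant_subspace_def rep_iso_def)
  have "f \<in> intertwiners G \<pi> \<tau>"
    using f(1) W(1) by (auto simp: intertwiners_def)
  then show "\<exists>f\<in>intertwiners G \<pi> \<tau>. inj_on f (vspace \<pi>) \<and> f ` vspace \<pi> \<noteq> vspace \<tau>"
    using f(2) W(2) by (auto simp: bij_betw_def)
next
  assume "\<exists>f\<in>intertwiners G \<pi> \<tau>. inj_on f (vspace \<pi>) \<and> f ` vspace \<pi> \<noteq> vspace \<tau>"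
  then obtain f where f: "f \<in> intertwiners G \<pi> \<tau>"
    and inj: "inj_on f (vspace \<pi>)" and ne: "f ` vspace \<pi> \<noteq> vspace \<tau>"
    by blast
  have sub: "complex_vector.subspace (vspace \<pi>)"
    and im: "\<And>g v. g \<in> carrier G \<Longrightarrow> v \<in> vspace \<pi> \<Longrightarrow> act \<pi> g v \<in> vspace \<pi>"
    using \<pi> by (auto simp: is_rep_def)
  have "0 \<in> f ` vspace \<pi>"
    using clinear_on_zero[OF intertwinersD(3)[OF f]] complex_vector.subspace_0[OF sub]
    by (metis image_eqI)
  moreover have "f u + f v \<in> f ` vspace \<pi>" "c *\<^sub>C f v \<in> f ` vspace \<pi>"
    if "u \<in> vspace \<pi>" "v \<in> vspace \<pi>" for u v c
    using that intertwinersD(3)[OF f] complex_vector.subspace_add[OF sub]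
      complex_vector.subspace_scale[OF sub]
    unfolding clinear_on_def by (metis image_eqI)+
  ultimately have "complex_vector.subspace (f ` vspace \<pi>)"
    by (auto intro!: complex_vector.subspaceI)
  then have "invariant_subspace G (f ` vspace \<pi>) \<tau>"
    using intertwinersD(2)[OF f] im
    by (auto simp: invariant_subspace_def intertwinersD(4)[OF f, symmetric])
  moreover have "rep_iso G \<pi> (\<tau>\<lparr>vspace := f ` vspace \<pi>\<rparr>)"
    unfolding rep_iso_def using f inj
    by (intro bexI[of _ f]) (auto simp: intertwiners_def bij_betw_def)
  ultimately show "iso_proper_subrep G \<pi> \<tau>"
    using ne unfolding iso_proper_subrep_def by blast
qed

text \<open>As a cardinality, the dimension would also be 0 for an infinite basis;
  \<open>fin_dim_intertwiners\<close> rules this out.\<close>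

lemma intertwining_number_eq_0_iff:
  assumes "is_rep G \<pi>" and "is_rep G \<tau>"
  shows "intertwining_number G \<pi> \<tau> = 0 \<longleftrightarrow> intertwiners G \<pi> \<tau> \<subseteq> {0}"
proof -
  let ?I = "intertwiners G \<pi> \<tau>"
  obtain B where B: "B \<subseteq> ?I" "complex_vector.independent B" "?I \<subseteq> complex_vector.span B"
    "card B = complex_vector.dim ?I"
    by (rule complex_vector.basis_exists)
  obtain C where "finite C" "?I \<subseteq> complex_vector.span C"
    using fin_dim_intertwiners[OF assms] by (auto simp: fin_dim_def)
  then have fin: "finite B"
    using complex_vector.independent_span_bound[OF _ B(2)] B(1) by blast
  have "?I \<subseteq> {0}" if "B = {}"
    using B(3) that by simp
  moreover have "B = {}" if "?I \<subseteq> {0}"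
    using that B(1,2) complex_vector.dependent_zero[of B] by auto
  ultimately show ?thesis
    using fin B(4) by (auto simp: intertwining_number_def)
qed

section \<open>Embeddings of Young modules\<close>

lemma sum_list_diagram: "D \<in> young_diagrams n \<Longrightarrow> sum_list D = n"
  by (simp add: young_diagrams_def)

lemma act_young_module:
  "act (young_module n D) g f = (\<lambda>x. if x permutes {1..n} then f (x \<circ> g) else 0)"
  by (simp add: young_module_def ind_rep_def sym_group_carrier sym_group_mult fun_eq_iff)

text \<open>Two permutations \<open>x\<close>, \<open>y\<close> give the same word exactly if
  \<open>x \<circ> inv' y\<close> stabilises \<open>colour D\<close>, that is, if they lie in the
  same coset. So the module consists of the functions of the word
  \<open>colour D \<circ> x\<close>.\<close>

lemma mem_young_module_iff:
  assumes "sum_list D = n"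
  shows "f \<in> vspace (young_module n D) \<longleftrightarrow>
    (\<forall>x. \<not> x permutes {1..n} \<longrightarrow> f x = 0) \<and>
    (\<forall>x y. x permutes {1..n} \<longrightarrow> y permutes {1..n} \<longrightarrow> colour D \<circ> x = colour D \<circ> y \<longrightarrow> f x = f y)"
    (is "_ \<longleftrightarrow> ?out \<and> ?inv")
proof -
  have "f \<in> vspace (young_module n D) \<longleftrightarrow> ?out \<and>
      (\<forall>h x. h permutes {1..n} \<and> colour D \<circ> h = colour D \<longrightarrow> x permutes {1..n} \<longrightarrow> f (h \<circ> x) = f x)"
    by (auto simp: young_module_def ind_rep_def trivial_rep_def sym_group_carrier sym_group_mult
        mem_young_subgroup_iff[OF assms] simp del: One_nat_def)
  moreover have "(\<forall>h x. h permutes {1..n} \<and> colour D \<circ> h = colour D \<longrightarrow> x permutes {1..n} \<longrightarrow>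
      f (h \<circ> x) = f x) \<longleftrightarrow> ?inv" (is "?l \<longleftrightarrow> _")
  proof
    assume l: ?l
    show ?inv
    proof (intro allI impI)
      fix x y assume x: "x permutes {1..n}" and y: "y permutes {1..n}"
        and eq: "colour D \<circ> x = colour D \<circ> y"
      let ?h = "x \<circ> inv' y"
      have "colour D \<circ> ?h = colour D \<circ> y \<circ> inv' y"
        unfolding comp_assoc[symmetric] eq ..
      then have "colour D \<circ> ?h = colour D"
        by (simp add: comp_assoc permutes_inv_o[OF y])
      moreover have "?h permutes {1..n}"
        by (intro permutes_compose permutes_inv x y)
      moreover have "?h \<circ> y = x"
        by (simp add: comp_assoc permutes_inv_o[OF y])
      ultimately show "f x = f y"
        using l y by metis
    qed
  next
    assume r: ?inv
    show ?l
    proof (intro allI impI)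
      fix h x assume h: "h permutes {1..n} \<and> colour D \<circ> h = colour D" and x: "x permutes {1..n}"
      then have "colour D \<circ> (h \<circ> x) = colour D \<circ> x"
        by (simp add: comp_assoc[symmetric])
      then show "f (h \<circ> x) = f x"
        using r h x permutes_compose[OF x, of h] by blast
    qed
  qed
  ultimately show ?thesis by simp
qed

text \<open>The element \<open>f\<close> as a function on words. The choice of a representative is
  harmless by \<open>word_fun_colour\<close>; the value 0 at words of other contents makes
  \<open>move_letter\<close> applicable.\<close>

definition word_fun ::
  "nat \<Rightarrow> nat list \<Rightarrow> ((nat \<Rightarrow> nat) \<Rightarrow> complex) \<Rightarrow> (nat \<Rightarrow> nat) \<Rightarrow> complex"
  where "word_fun n D f w =
    (if w \<in> words n D then f (SOME x. x permutes {1..n} \<and> colour D \<circ> x = w) else 0)"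

lemma word_fun_colour:
  assumes "sum_list D = n" and "f \<in> vspace (young_module n D)" and x: "x permutes {1..n}"
  shows "word_fun n D f (colour D \<circ> x) = f x"
proof -
  let ?y = "SOME y. y permutes {1..n} \<and> colour D \<circ> y = colour D \<circ> x"
  have "?y permutes {1..n} \<and> colour D \<circ> ?y = colour D \<circ> x"
    using someI[of "\<lambda>y. y permutes {1..n} \<and> colour D \<circ> y = colour D \<circ> x" x] x by blast
  then have "f ?y = f x"
    using assms(2) x unfolding mem_young_module_iff[OF assms(1)] by blast
  then show ?thesis
    using words_comp_iff[OF x] colour_in_words[OF assms(1)] by (simp add: word_fun_def)
qed

lemma word_fun_add: "word_fun n D (f + g) w = word_fun n D f w + word_fun n D g w"
  by (simp add: word_fun_def)

lemma word_fun_scale: "word_fun n D (c *\<^sub>C f) w = c * word_fun n D f w"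
  by (simp add: word_fun_def scaleC_complex_def)

lemma word_fun_act:
  assumes D: "sum_list D = n" and f: "f \<in> vspace (young_module n D)" and g: "g permutes {1..n}"
  shows "word_fun n D (act (young_module n D) g f) w = word_fun n D f (w \<circ> g)"
proof (cases "w \<in> words n D")
  case True
  then obtain x where x: "x permutes {1..n}" "w = colour D \<circ> x"
    using words_conjugate[OF colour_in_words[OF D]] by metis
  have "act (young_module n D) g f \<in> vspace (young_module n D)"
    using act_closed[OF is_rep_young_module _ f] g by (simp add: sym_group_carrier)
  then have "word_fun n D (act (young_module n D) g f) w = f (x \<circ> g)"
    using word_fun_colour[OF D _ x(1)] x by (simp add: act_young_module)
  also have "\<dots> = word_fun n D f (w \<circ> g)"
    using word_fun_colour[OF D f permutes_compose[OF g x(1)]] x(2) by (simp add: comp_assoc)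
  finally show ?thesis .
next
  case False
  then show ?thesis
    using words_comp_iff[OF g, of w D] by (simp add: word_fun_def)
qed

text \<open>Permuting positions commutes with an operator that treats all positions alike; this is
  the source of equivariance.\<close>

lemma move_letter_comp:
  assumes g: "g permutes A"
  shows "move_letter A i j (\<lambda>w. \<phi> (w \<circ> g)) w = move_letter A i j \<phi> (w \<circ> g)"
proof -
  have "w(g q := i) \<circ> g = (w \<circ> g)(q := i)" for q
    using permutes_inj[OF g] by (auto simp: fun_eq_iff inj_eq)
  then have "(\<Sum>q\<in>{q \<in> A. w (g q) = j}. \<phi> ((w \<circ> g)(q := i))) =
      (\<Sum>q\<in>{q \<in> A. w (g q) = j}. \<phi> (w(g q := i) \<circ> g))"
    by simp
  also have "\<dots> = (\<Sum>p\<in>{p \<in> A. w p = j}. \<phi> (w(p := i) \<circ> g))"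
    by (rule sum.reindex_bij_betw[OF bij_betw_permutes_filter[OF g]])
  finally show ?thesis
    by (simp add: move_letter_def)
qed

text \<open>Used contrapositively: at a word outside \<open>words n D\<close> every term of
  \<open>move_letter\<close> vanishes, so a function killed on \<open>words n D\<close> is killed
  everywhere.\<close>

lemma words_move_letter:
  assumes "w(p := i) \<in> words n E" and p: "p \<in> {1..n}" "w p = j" and "i \<noteq> j"
    and row: "row D = (row E)(i := row E i - 1, j := row E j + 1)"
  shows "w \<in> words n D"
proof -
  let ?w = "w(p := i)"
  have "w q = 0" if "q \<notin> {1..n}" for q
  proof -
    have "q \<noteq> p" using that p(1) by blast
    then show ?thesis using words_outside[OF assms(1) that] by simp
  qed
  moreover have "card {q \<in> {1..n}. w q = r} = row D r" for r
  proof -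
    consider "r = i" | "r = j" | "r \<noteq> i" "r \<noteq> j" by blast
    then show ?thesis
    proof cases
      case 1
      then have "{q \<in> {1..n}. w q = r} = {q \<in> {1..n}. ?w q = i} - {p}"
        using p(2) \<open>i \<noteq> j\<close> by auto
      then have "card {q \<in> {1..n}. w q = r} = card {q \<in> {1..n}. ?w q = i} - 1"
        using p(1) by simp
      then show ?thesis
        unfolding card_words[OF assms(1)] using 1 \<open>i \<noteq> j\<close> by (simp add: row)
    next
      case 2
      then have "{q \<in> {1..n}. w q = r} = insert p {q \<in> {1..n}. ?w q = j}"
        using p \<open>i \<noteq> j\<close> by auto
      moreover have "p \<notin> {q \<in> {1..n}. ?w q = j}"
        using \<open>i \<noteq> j\<close> by simp
      ultimately have "card {q \<in> {1..n}. w q = r} = card {q \<in> {1..n}. ?w q = j} + 1"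
        using card_insert_disjoint[of "{q \<in> {1..n}. ?w q = j}" p] by simp
      then show ?thesis
        unfolding card_words[OF assms(1)] using 2 by (simp add: row)
    next
      case 3
      then have "{q \<in> {1..n}. w q = r} = {q \<in> {1..n}. ?w q = r}"
        using p(2) by auto
      then show ?thesis
        using card_words[OF assms(1), of r] 3 by (simp add: row)
    qed
  qed
  ultimately show ?thesis
    unfolding words_def by blast
qed

lemma rep_embeds_box_move:
  assumes D: "D \<in> young_diagrams n" and E: "E \<in> young_diagrams n" and "box_move D E"
  shows "rep_embeds (sym_group n) (young_module n E) (young_module n D)"
proof -
  let ?V = "vspace (young_module n E)" and ?A = "{1..n}"
  obtain i j where ij: "i < j" "0 < row E i"
    and row: "row D = (row E)(i := row E i - 1, j := row E j + 1)"
    using assms(3) unfolding box_move_def by blast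
  have sD: "sum_list D = n" and sE: "sum_list E = n"
    using D E by (auto simp: sum_list_diagram)
  have sub: "complex_vector.subspace ?V"
    using is_rep_young_module[of n E] by (simp add: is_rep_def)
  have closed: "act (young_module n E) g f \<in> ?V" if "g permutes ?A" "f \<in> ?V" for g f
    using act_closed[OF is_rep_young_module _ that(2)] that(1) by (simp add: sym_group_carrier)
  define T where "T f x = (if f \<in> ?V \<and> x permutes ?A
    then move_letter ?A i j (word_fun n E f) (colour D \<circ> x) else 0)" for f x
  have lin: "clinear_on ?V T"
    using complex_vector.subspace_add[OF sub] complex_vector.subspace_scale[OF sub]
    by (auto simp: clinear_on_def T_def fun_eq_iff move_letter_def word_fun_add word_fun_scale
        scaleC_complex_def sum.distrib sum_distrib_left)
  have "T f \<in> vspace (young_module n D)" if "f \<in> ?V" for f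
    using that unfolding mem_young_module_iff[OF sD] by (simp add: T_def)
  moreover have "T (act (young_module n E) g f) = act (young_module n D) g (T f)"
    if g: "g permutes ?A" and f: "f \<in> ?V" for g f
  proof
    fix x
    show "T (act (young_module n E) g f) x = act (young_module n D) g (T f) x"
    proof (cases "x permutes ?A")
      case True
      have "T (act (young_module n E) g f) x =
          move_letter ?A i j (\<lambda>w. word_fun n E f (w \<circ> g)) (colour D \<circ> x)"
        using True closed[OF g f] by (simp add: T_def move_letter_def word_fun_act[OF sE f g])
      also have "\<dots> = move_letter ?A i j (word_fun n E f) (colour D \<circ> (x \<circ> g))"
        unfolding move_letter_comp[OF g] comp_assoc ..
      also have "\<dots> = act (young_module n D) g (T f) x"
        using True f permutes_compose[OF g True] by (simp add: T_def act_young_module)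
      finally show ?thesis .
    qed (simp add: T_def act_young_module)
  qed
  ultimately have "T \<in> intertwiners (sym_group n) (young_module n E) (young_module n D)"
    using lin by (auto simp: intertwiners_def sym_group_carrier T_def fun_eq_iff simp del: One_nat_def)
  moreover have "inj_on T ?V"
  proof (rule clinear_on_inj_onI[OF lin sub])
    fix f assume f: "f \<in> ?V" and "T f = 0"
    let ?\<phi> = "word_fun n E f"
    \<comment> \<open>A finite set of words closed under writing \<open>i\<close> or
      \<open>j\<close>: letters of words of content \<open>E\<close> and \<open>i\<close> itself are
      below \<open>n\<close>, and adding \<open>j\<close> to the bound admits the letter
      \<open>j\<close>.\<close>
    define W where
      "W = {w. \<forall>p. (p \<in> ?A \<longrightarrow> w p \<in> {..<Suc (n + j)}) \<and> (p \<notin> ?A \<longrightarrow> w p = (0::nat))}"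
    have Tf: "move_letter ?A i j ?\<phi> (colour D \<circ> x) = 0" if "x permutes ?A" for x
      using \<open>T f = 0\<close> f that unfolding T_def fun_eq_iff by (metis zero_fun_apply)
    have i: "i < n"
      using ij(2) row_eq_0[OF E, of i] by (cases "i < n") auto
    \<comment> \<open>That \<open>D\<close> is a diagram enters here: it makes the constant in the
      norm identity positive.\<close>
    have "row D j \<le> row D i"
      using ij(1) by (intro row_antimono[OF D]) simp
    then have less: "row E j < row E i"
      using ij row by auto
    have zero: "?\<phi> w = 0" if "w \<in> W" for w
    proof (rule move_letter_injective[where W = W and A = ?A and \<phi> = ?\<phi> and i = i and j = j
          and a = "row E i" and b = "row E j"])
      show "finite W"
        unfolding W_def by (intro finite_set_of_finite_funs) simp_all
      show "u(p := i) \<in> W \<and> u(p := j) \<in> W" if "u \<in> W" "p \<in> ?A" for u p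
        using that i by (auto simp: W_def)
      show "card {p \<in> ?A. u p = i} = row E i \<and> card {p \<in> ?A. u p = j} = row E j"
        if "?\<phi> u \<noteq> 0" for u
        using that card_words[of u n E] by (simp add: word_fun_def split: if_splits)
      show "move_letter ?A i j ?\<phi> u = 0" for u
      proof (cases "u \<in> words n D")
        case True
        then show ?thesis
          using words_conjugate[OF colour_in_words[OF sD]] Tf by metis
      next
        case False
        have "u(p := i) \<notin> words n E" if "p \<in> ?A" "u p = j" for p
          using words_move_letter[of u p i n E j D] that ij(1) row False by auto
        then show ?thesis
          by (auto simp: move_letter_def word_fun_def intro!: sum.neutral)
      qed
    qed (use ij less that in auto)
    have "colour E \<circ> x \<in> W" if x: "x permutes ?A" for x
    proof -
      have w: "colour E \<circ> x \<in> words n E"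
        using words_comp_iff[OF x] colour_in_words[OF sE] by blast
      have "(colour E \<circ> x) p \<in> {..<Suc (n + j)}" if "p \<in> ?A" for p
      proof (rule ccontr)
        assume "(colour E \<circ> x) p \<notin> {..<Suc (n + j)}"
        then have "card {q \<in> ?A. (colour E \<circ> x) q = (colour E \<circ> x) p} = 0"
          unfolding card_words[OF w] by (intro row_eq_0[OF E]) simp
        then show False
          using that by (subst (asm) card_0_eq) auto
      qed
      then show ?thesis
        using words_outside[OF w] unfolding W_def by blast
    qed
    then have "f x = 0" if "x permutes ?A" for x
      using zero word_fun_colour[OF sE f that] that by metis
    moreover have "f x = 0" if "\<not> x permutes ?A" for x
      using f that unfolding mem_young_module_iff[OF sE] by blast
    ultimately show "f = 0"
      by (metis ext zero_fun_apply)
  qed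
  ultimately show ?thesis
    unfolding rep_embeds_def by blast
qed

lemma rep_embeds_dominance:
  assumes "dominance n D E"
  shows "rep_embeds (sym_group n) (young_module n E) (young_module n D)"
  using assms unfolding dominance_def
proof (induction rule: rtranclp_induct)
  case base
  then show ?case by (intro rep_embeds_refl is_rep_young_module)
next
  case (step F E)
  then show ?case
    using rep_embeds_trans[OF rep_embeds_box_move _ is_rep_young_module] by blast
qed

section \<open>Intertwiners from twisted Young modules\<close>

lemma young_subgroup_permutes: "h \<in> young_subgroup n E \<Longrightarrow> h permutes {1..n}"
  by (simp add: young_subgroup_def sym_group_carrier)

lemma inv_young_subgroup: "h \<in> young_subgroup n E \<Longrightarrow> inv' h \<in> young_subgroup n E"
  using subgroup.m_inv_closed[OF subgroup_young_subgroup, of h n E]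
  by (simp add: sym_group_carrier young_subgroup_permutes del: One_nat_def)

lemma comp_young_subgroup:
  "g \<in> young_subgroup n E \<Longrightarrow> h \<in> young_subgroup n E \<Longrightarrow> g \<circ> h \<in> young_subgroup n E"
  using subgroup.m_closed[OF subgroup_young_subgroup, of g n E h] by (simp add: sym_group_mult)

lemma id_young_subgroup: "id \<in> young_subgroup n E"
  using subgroup.one_closed[OF subgroup_young_subgroup, of n E] by (simp add: sym_group_one)

lemma finite_young_subgroup: "finite (young_subgroup n E)"
  using finite_subset[OF subgroup.subset[OF subgroup_young_subgroup] finite_sym_group] .

lemma sign_comp_permutes:
  "p permutes {1..n::nat} \<Longrightarrow> q permutes {1..n} \<Longrightarrow> sign (p \<circ> q) = sign p * sign q"
  by (intro sign_compose) (auto simp: permutation_permutes)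

lemma sign_inv_permutes: "p permutes {1..n::nat} \<Longrightarrow> sign (inv' p) = sign p"
  by (intro sign_inverse) (auto simp: permutation_permutes)

lemma sign_comp_young_subgroup:
  "g \<in> young_subgroup n E \<Longrightarrow> h \<in> young_subgroup n E \<Longrightarrow> sign (g \<circ> h) = sign g * sign h"
  by (intro sign_comp_permutes[of _ n] young_subgroup_permutes)

lemma mem_young_module_sgn_iff:
  "f \<in> vspace (young_module_sgn n E) \<longleftrightarrow>
    (\<forall>x. \<not> x permutes {1..n} \<longrightarrow> f x = 0) \<and>
    (\<forall>h\<in>young_subgroup n E. \<forall>x. x permutes {1..n} \<longrightarrow> f (h \<circ> x) = of_int (sign h) * f x)"
  by (auto simp: young_module_sgn_def ind_rep_def sign_rep_def sym_group_carrier sym_group_mult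
      simp del: One_nat_def)

lemma act_young_module_sgn:
  "act (young_module_sgn n E) g f = (\<lambda>x. if x permutes {1..n} then f (x \<circ> g) else 0)"
  by (simp add: young_module_sgn_def ind_rep_def sym_group_carrier sym_group_mult fun_eq_iff)

text \<open>The vector of the induced module supported on the trivial coset. It generates the
  module, so as in Frobenius reciprocity an intertwiner is determined by its value there.\<close>

definition sgn_gen :: "nat \<Rightarrow> nat list \<Rightarrow> (nat \<Rightarrow> nat) \<Rightarrow> complex"
  where "sgn_gen n E x = (if x \<in> young_subgroup n E then of_int (sign x) else 0)"

lemma comp_young_subgroup_iff:
  assumes "h \<in> young_subgroup n E"
  shows "h \<circ> x \<in> young_subgroup n E \<longleftrightarrow> x \<in> young_subgroup n E"
    and "x \<circ> h \<in> young_subgroup n E \<longleftrightarrow> x \<in> young_subgroup n E"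
  using comp_young_subgroup[OF assms, of x] comp_young_subgroup[OF _ assms, of x]
    comp_young_subgroup[OF inv_young_subgroup[OF assms], of "h \<circ> x"]
    comp_young_subgroup[OF _ inv_young_subgroup[OF assms], of "x \<circ> h"]
    permutes_inv_o[OF young_subgroup_permutes[OF assms]]
  by (auto simp: comp_assoc) (auto simp: comp_assoc[symmetric])

lemma sgn_gen_in: "sgn_gen n E \<in> vspace (young_module_sgn n E)"
  unfolding mem_young_module_sgn_iff
  by (auto simp: sgn_gen_def comp_young_subgroup_iff sign_comp_young_subgroup
      young_subgroup_permutes dest: permutes_compose[OF _ young_subgroup_permutes] simp del: One_nat_def)

lemma act_sgn_gen:
  assumes "h \<in> young_subgroup n E"
  shows "act (young_module_sgn n E) h (sgn_gen n E) = of_int (sign h) *\<^sub>C sgn_gen n E"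
  using assms
  by (auto simp: act_young_module_sgn fun_eq_iff sgn_gen_def comp_young_subgroup_iff
      sign_comp_young_subgroup young_subgroup_permutes scaleC_complex_def simp del: One_nat_def)

text \<open>Summing over the whole group instead of coset representatives counts each coset
  \<open>card (young_subgroup n E)\<close> times, hence the division.\<close>

lemma young_module_sgn_expand:
  assumes f: "f \<in> vspace (young_module_sgn n E)"
  shows "f = (\<Sum>g | g permutes {1..n}.
    (f (inv' g) / of_nat (card (young_subgroup n E))) *\<^sub>C act (young_module_sgn n E) g (sgn_gen n E))"
proof
  fix x
  let ?H = "young_subgroup n E"
  let ?c = "of_nat (card ?H) :: complex"
  show "f x = (\<Sum>g | g permutes {1..n}.
    (f (inv' g) / ?c) *\<^sub>C act (young_module_sgn n E) g (sgn_gen n E)) x"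
  proof (cases "x permutes {1..n}")
    case False
    then show ?thesis
      using f by (simp add: sum_fun_apply act_young_module_sgn mem_young_module_sgn_iff
          scaleC_complex_def)
  next
    case x: True
    have "card ?H \<noteq> 0"
      using finite_young_subgroup id_young_subgroup by (metis card_0_eq empty_iff)
    have "(\<Sum>g | g permutes {1..n}.
        (f (inv' g) / ?c) *\<^sub>C act (young_module_sgn n E) g (sgn_gen n E)) x =
      (\<Sum>g | g permutes {1..n}. f (inv' g) / ?c * sgn_gen n E (x \<circ> g))"
      using x by (simp add: sum_fun_apply act_young_module_sgn scaleC_complex_def)
    also have "\<dots> = (\<Sum>h\<in>?H. f (inv' h \<circ> x) / ?c * of_int (sign h))"
(is "?l = _")
    proof -
      have inv: "inv' x permutes {1..n}" "x \<circ> (inv' x \<circ> g) = g" "inv' x \<circ> (x \<circ> g) = g"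
        for g :: "nat \<Rightarrow> nat"
        using permutes_inv[OF x] permutes_inv_o[OF x] by (simp_all add: comp_assoc[symmetric])
      \<comment> \<open>Only \<open>g\<close> with \<open>x \<circ> g\<close> in the subgroup
        contribute; with \<open>h = x \<circ> g\<close> the argument \<open>inv' g\<close> becomes
        \<open>inv' h \<circ> x\<close>.\<close>
      have "?l = (\<Sum>g | g permutes {1..n} \<and> x \<circ> g \<in> ?H. f (inv' g) / ?c * sgn_gen n E (x \<circ> g))"
        by (rule sum.mono_neutral_right) (auto simp: finite_permutations sgn_gen_def)
      also have "\<dots> = (\<Sum>h\<in>?H. f (inv' h \<circ> x) / ?c * of_int (sign h))"
      proof (rule sum.reindex_bij_witness[of _ "\<lambda>h. inv' x \<circ> h" "\<lambda>g. x \<circ> g"])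
        fix g assume g: "g \<in> {g. g permutes {1..n} \<and> x \<circ> g \<in> ?H}"
        then have "inv' (x \<circ> g) = inv' g \<circ> inv' x"
          using x by (intro o_inv_distrib permutes_bij) auto
        then have "inv' (x \<circ> g) \<circ> x = inv' g"
          using permutes_inv_o(2)[OF x] by (simp add: comp_assoc)
        then show "f (inv' (x \<circ> g) \<circ> x) / ?c * of_int (sign (x \<circ> g)) =
            f (inv' g) / ?c * sgn_gen n E (x \<circ> g)"
          using g by (simp add: sgn_gen_def)
      next
        fix h assume h: "h \<in> ?H"
        then show "inv' x \<circ> h \<in> {g. g permutes {1..n} \<and> x \<circ> g \<in> ?H}"
          using permutes_compose[OF young_subgroup_permutes[OF h] inv(1)] inv(2) by simp
      qed (use inv in auto)
      finally show ?thesis .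
    qed
    also have "\<dots> = (\<Sum>h\<in>?H. f x / ?c)"
    proof (rule sum.cong[OF refl])
      fix h assume h: "h \<in> ?H"
      have "f (inv' h \<circ> x) = of_int (sign h) * f x"
        using f inv_young_subgroup[OF h] x sign_inv_permutes[OF young_subgroup_permutes[OF h]]
        unfolding mem_young_module_sgn_iff by metis
      moreover have "(of_int (sign h) :: complex) * of_int (sign h) = 1"
        by (cases rule: sign_cases[of h]) simp_all
      ultimately show "f (inv' h \<circ> x) / ?c * of_int (sign h) = f x / ?c"
        by (simp add: field_simps)
    qed
    also have "\<dots> = f x"
      using \<open>card ?H \<noteq> 0\<close> by simp
    finally show ?thesis ..
  qed
qed


lemma intertwiner_eq_0_if_sgn_gen:
  assumes F: "F \<in> intertwiners (sym_group n) (young_module_sgn n E) \<tau>"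
    and \<tau>: "is_rep (sym_group n) \<tau>" and zero: "F (sgn_gen n E) = 0"
  shows "F = 0"
proof
  fix f
  let ?V = "vspace (young_module_sgn n E)"
  have sub: "complex_vector.subspace ?V"
    using is_rep_young_module_sgn[of n E] by (simp add: is_rep_def)
  have "0 \<in> vspace \<tau>" and lin: "\<And>g. g \<in> carrier (sym_group n) \<Longrightarrow> clinear_on (vspace \<tau>) (act \<tau> g)"
    using \<tau> complex_vector.subspace_0 by (auto simp: is_rep_def)
  then have act0: "act \<tau> g 0 = 0" if "g permutes {1..n}" for g
    using that clinear_on_zero unfolding sym_group_carrier by blast
  have "F f = 0" if "f \<in> ?V"
  proof -
    let ?g = "\<lambda>g. act (young_module_sgn n E) g (sgn_gen n E)"
    have g: "?g g \<in> ?V" "F (?g g) = 0" if "g permutes {1..n}" for g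
    proof -
      have "g \<in> carrier (sym_group n)"
        using that by (simp only: sym_group_carrier)
      then show "?g g \<in> ?V" "F (?g g) = 0"
        using act_closed[OF is_rep_young_module_sgn _ sgn_gen_in] act0[OF that]
          intertwinersD(4)[OF F _ sgn_gen_in] zero by simp_all
    qed
    have "F f = (\<Sum>g | g permutes {1..n}.
        (f (inv' g) / of_nat (card (young_subgroup n E))) *\<^sub>C F (?g g))"
      by (subst young_module_sgn_expand[OF that], rule clinear_on_sum[OF intertwinersD(3)[OF F] sub])
        (use g in blast)
    then show ?thesis
      using g by simp
  qed
  then show "F f = 0 f"
    using intertwinersD(1)[OF F] by (cases "f \<in> ?V") auto
qed

text \<open>Left invariance comes from the target module, the sign on the right from the action of
  S_E on the generator.\<close>

lemma image_sgn_gen: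
  assumes D: "sum_list D = n"
    and F: "F \<in> intertwiners (sym_group n) (young_module_sgn n E) (young_module n D)"
  defines "\<psi> \<equiv> F (sgn_gen n E)"
  shows "\<psi> \<in> vspace (young_module n D)"
    and "\<And>x h. x permutes {1..n} \<Longrightarrow> h \<in> young_subgroup n E \<Longrightarrow> \<psi> (x \<circ> h) = of_int (sign h) * \<psi> x"
proof -
  show "\<psi> \<in> vspace (young_module n D)"
    unfolding \<psi>_def using intertwinersD(2)[OF F sgn_gen_in] .
  fix x h assume x: "x permutes {1..n}" and h: "h \<in> young_subgroup n E"
  then have "h \<in> carrier (sym_group n)"
    by (simp add: young_subgroup_def)
  then have "act (young_module n D) h \<psi> = F (of_int (sign h) *\<^sub>C sgn_gen n E)"
    unfolding \<psi>_def act_sgn_gen[OF h, symmetric]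
    using intertwinersD(4)[OF F _ sgn_gen_in] by simp
  also have "\<dots> = of_int (sign h) *\<^sub>C \<psi>"
    unfolding \<psi>_def using intertwinersD(3)[OF F] sgn_gen_in unfolding clinear_on_def by blast
  finally have "act (young_module n D) h \<psi> x = (of_int (sign h) *\<^sub>C \<psi>) x"
    by simp
  then show "\<psi> (x \<circ> h) = of_int (sign h) * \<psi> x"
    using x by (simp add: act_young_module scaleC_complex_def)
qed

text \<open>A transposition exchanging two points with equal pairs of colours forces \<open>\<psi> x = - \<psi> x\<close>.\<close>

lemma image_sgn_gen_support:
  assumes D: "sum_list D = n" and E: "sum_list E = n"
    and F: "F \<in> intertwiners (sym_group n) (young_module_sgn n E) (young_module n D)"
    and x: "x permutes {1..n}" and nz: "F (sgn_gen n E) x \<noteq> 0"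
  shows "inj_on (\<lambda>p. (colour E p, (colour D \<circ> x) p)) {1..n}"
proof (rule inj_onI, rule ccontr)
  fix p q assume p: "p \<in> {1..n}" and q: "q \<in> {1..n}" and "p \<noteq> q"
    and "(colour E p, (colour D \<circ> x) p) = (colour E q, (colour D \<circ> x) q)"
  then have eq: "colour E p = colour E q" "(colour D \<circ> x) p = (colour D \<circ> x) q"
    by auto
  let ?h = "Transposition.transpose p q"
  have comp: "c \<circ> ?h = c" if "c p = c q" for c :: "nat \<Rightarrow> nat"
    using that by (auto simp: fun_eq_iff Transposition.transpose_def)
  have h: "?h permutes {1..n}"
    using p q by (rule permutes_swap_id)
  then have "?h \<in> young_subgroup n E"
    unfolding mem_young_subgroup_iff[OF E] using comp[OF eq(1)] by blast
  then have "F (sgn_gen n E) (x \<circ> ?h) = - F (sgn_gen n E) x"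
    using image_sgn_gen(2)[OF D F x] \<open>p \<noteq> q\<close> by (simp add: sign_swap_id)
  moreover have "colour D \<circ> (x \<circ> ?h) = colour D \<circ> x"
    unfolding comp_assoc[symmetric] by (rule comp[OF eq(2)])
  then have "F (sgn_gen n E) (x \<circ> ?h) = F (sgn_gen n E) x"
    using image_sgn_gen(1)[OF D F] x permutes_compose[OF h x]
    unfolding mem_young_module_iff[OF D] by blast
  ultimately show False
    using nz by simp
qed

section \<open>Pairs of words whose blocks meet in at most one point\<close>

lemma inj_on_pairD:
  assumes "inj_on (\<lambda>p. (v p, w p)) A"
  shows "inj_on w {p \<in> A. v p = r}" and "inj_on v {p \<in> A. w p = s}"
  using assms unfolding inj_on_def by blast+

text \<open>Entry \<open>(r, s)\<close> of the intersection matrix counts the positions with letters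
  \<open>r\<close> and \<open>s\<close>; injectivity bounds it by 1, so the image of the pair map
  carries the whole matrix.\<close>

lemma zero_one_if_inj:
  assumes v: "v \<in> words n E" and w: "w \<in> words n D"
    and inj: "inj_on (\<lambda>p. (v p, w p)) {1..n}"
  shows "zero_one E D ((\<lambda>p. (v p, w p)) ` {1..n})"
proof -
  let ?S = "(\<lambda>p. (v p, w p)) ` {1..n}"
  have "card {s. (r, s) \<in> ?S} = row E r" for r
  proof -
    have "{s. (r, s) \<in> ?S} = w ` {p \<in> {1..n}. v p = r}"
      by force
    moreover have "inj_on w {p \<in> {1..n}. v p = r}"
      by (rule inj_on_pairD(1)[OF inj])
    ultimately show ?thesis
      by (simp only: card_image card_words[OF v])
  qed
  moreover have "card {r. (r, s) \<in> ?S} = row D s" for s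
  proof -
    have "{r. (r, s) \<in> ?S} = v ` {p \<in> {1..n}. w p = s}"
      by force
    moreover have "inj_on v {p \<in> {1..n}. w p = s}"
      by (rule inj_on_pairD(2)[OF inj])
    ultimately show ?thesis
      by (simp only: card_image card_words[OF w])
  qed
  ultimately show ?thesis
    by (simp add: zero_one_def)
qed

text \<open>The positions with letter \<open>r\<close> in \<open>v\<close> are matched with the ones
  in row \<open>r\<close> by any bijection; \<open>w\<close> records the column.\<close>

lemma inj_if_zero_one:
  assumes v: "v \<in> words n E" and S: "zero_one E D S"
  obtains w where "w \<in> words n D" and "inj_on (\<lambda>p. (v p, w p)) {1..n}"
proof -
  have fin: "finite S" and rows: "\<And>r. card {s. (r, s) \<in> S} = row E r"
    and cols: "\<And>s. card {r. (r, s) \<in> S} = row D s"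
    using S by (auto simp: zero_one_def)
  have "finite {s. (r, s) \<in> S}" for r
    using finite_subset[of "{s. (r, s) \<in> S}" "snd ` S"] fin by force
  moreover have "finite {p \<in> {1..n}. v p = r}" for r
    by simp
  ultimately have "\<exists>b. bij_betw b {p \<in> {1..n}. v p = r} {s. (r, s) \<in> S}" for r
    by (intro finite_same_card_bij) (simp_all only: rows card_words[OF v])
  then obtain b where b: "\<And>r. bij_betw (b r) {p \<in> {1..n}. v p = r} {s. (r, s) \<in> S}"
    by metis
  define w where "w p = (if p \<in> {1..n} then b (v p) p else 0)" for p
  have inj: "inj_on (\<lambda>p. (v p, w p)) {1..n}"
  proof (rule inj_onI)
    fix p q assume "p \<in> {1..n}" "q \<in> {1..n}" "(v p, w p) = (v q, w q)"
    then show "p = q"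
      using bij_betw_imp_inj_on[OF b[of "v p"]] by (auto simp: w_def inj_on_def)
  qed
  have "card {p \<in> {1..n}. w p = s} = row D s" for s
  proof -
    have "v ` {p \<in> {1..n}. w p = s} = {r. (r, s) \<in> S}"
    proof (intro equalityI subsetI)
      fix r assume "r \<in> v ` {p \<in> {1..n}. w p = s}"
      then obtain p where "p \<in> {1..n}" "w p = s" "r = v p"
        by blast
      then show "r \<in> {r. (r, s) \<in> S}"
        using bij_betw_imp_surj_on[OF b[of r]] by (auto simp: w_def)
    next
      fix r assume "r \<in> {r. (r, s) \<in> S}"
      then have "s \<in> b r ` {p \<in> {1..n}. v p = r}"
        using bij_betw_imp_surj_on[OF b[of r]] by blast
      then show "r \<in> v ` {p \<in> {1..n}. w p = s}"
        by (auto simp: w_def)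
    qed
    moreover have "inj_on v {p \<in> {1..n}. w p = s}"
      by (rule inj_on_pairD(2)[OF inj])
    ultimately show ?thesis
      using card_image[of v "{p \<in> {1..n}. w p = s}"] cols[of s] by simp
  qed
  then have "w \<in> words n D"
    unfolding words_def by (auto simp: w_def)
  then show thesis
    using inj by (rule that)
qed

text \<open>
  The permutation \<open>x\<close> realises the matrix as the pairs of colours of \<open>p\<close> and \<open>x p\<close>. Summing \<open>f (x\<^sup>-\<^sup>1 k y)\<close>
  over \<open>k \<in> S\<^sub>D\<close> is an intertwiner, and at \<open>y = x\<close> only \<open>k = 1\<close> contributes for the generator, because
  \<open>S\<^sub>E\<close> and \<open>x\<^sup>-\<^sup>1 S\<^sub>D x\<close> intersect trivially.
\<close>

lemma nonzero_intertwiner: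
  assumes D: "sum_list D = n" and E: "sum_list E = n" and S: "zero_one E D S"
  shows "\<exists>F\<in>intertwiners (sym_group n) (young_module_sgn n E) (young_module n D). F \<noteq> 0"
proof -
  let ?V = "vspace (young_module_sgn n E)" and ?K = "young_subgroup n D"
  obtain w where w: "w \<in> words n D" and "inj_on (\<lambda>p. (colour E p, w p)) {1..n}"
    using inj_if_zero_one[OF colour_in_words[OF E] S] by blast
  moreover obtain x where x: "x permutes {1..n}" "w = colour D \<circ> x"
    using words_conjugate[OF colour_in_words[OF D] w] by blast
  ultimately have inj: "inj_on (\<lambda>p. (colour E p, colour D (x p))) {1..n}"
    by simp
  have x': "inv' x permutes {1..n}" "x \<circ> inv' x = id" "inv' x \<circ> x = id"
    using permutes_inv[OF x(1)] permutes_inv_o[OF x(1)] by auto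
  define F where "F f y =
    (if f \<in> ?V \<and> y permutes {1..n} then \<Sum>k\<in>?K. f (inv' x \<circ> k \<circ> y) else 0)" for f and y :: "nat \<Rightarrow> nat"
  have sub: "complex_vector.subspace ?V"
    using is_rep_young_module_sgn[of n E] by (simp add: is_rep_def)
  have "clinear_on ?V F"
    using complex_vector.subspace_add[OF sub] complex_vector.subspace_scale[OF sub]
    by (auto simp: clinear_on_def F_def fun_eq_iff scaleC_complex_def sum.distrib sum_distrib_left)
  moreover have "F f \<in> vspace (young_module n D)" if f: "f \<in> ?V" for f
  proof -
    have "F f (h \<circ> y) = F f y" if h: "h \<in> ?K" and y: "y permutes {1..n}" for h y
    proof -
      have "h \<circ> y permutes {1..n}"
        by (intro permutes_compose y young_subgroup_permutes[OF h])
      then have "F f (h \<circ> y) = (\<Sum>k\<in>?K. f (inv' x \<circ> (k \<circ> h) \<circ> y))"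
        using f by (simp add: F_def comp_assoc)
      also have "\<dots> = (\<Sum>k\<in>?K. f (inv' x \<circ> k \<circ> y))"
        using permutes_inv_o[OF young_subgroup_permutes[OF h]]
        by (intro sum.reindex_bij_witness[of _ "\<lambda>k. k \<circ> inv' h" "\<lambda>k. k \<circ> h"])
          (auto simp: comp_assoc comp_young_subgroup[OF _ h]
            comp_young_subgroup[OF _ inv_young_subgroup[OF h]])
      finally show ?thesis
        using f y by (simp add: F_def)
    qed
    then show ?thesis
      by (auto simp: young_module_def ind_rep_def trivial_rep_def sym_group_carrier sym_group_mult
          F_def simp del: One_nat_def)
  qed
  moreover have "F (act (young_module_sgn n E) g f) = act (young_module n D) g (F f)"
    if g: "g \<in> carrier (sym_group n)" and f: "f \<in> ?V" for g f
  proof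
    fix y
    have gf: "act (young_module_sgn n E) g f \<in> ?V"
      by (rule act_closed[OF is_rep_young_module_sgn g f])
    show "F (act (young_module_sgn n E) g f) y = act (young_module n D) g (F f) y"
    proof (cases "y permutes {1..n}")
      case True
      have "inv' x \<circ> k \<circ> y permutes {1..n}" if "k \<in> ?K" for k
        by (intro permutes_compose True young_subgroup_permutes[OF that] x')
      moreover have "y \<circ> g permutes {1..n}"
        using g True by (intro permutes_compose) (simp_all add: sym_group_carrier)
      ultimately show ?thesis
        using True f gf by (simp add: F_def act_young_module act_young_module_sgn comp_assoc)
    qed (simp add: F_def act_young_module)
  qed
  ultimately have "F \<in> intertwiners (sym_group n) (young_module_sgn n E) (young_module n D)"
    by (auto simp: intertwiners_def F_def fun_eq_iff)
  moreover have "F (sgn_gen n E) x \<noteq> 0"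
  proof -
    have "sgn_gen n E (inv' x \<circ> k \<circ> x) = (if k = id then 1 else 0)" if k: "k \<in> ?K" for k
    proof (cases "inv' x \<circ> k \<circ> x \<in> young_subgroup n E")
      case True
      let ?h = "inv' x \<circ> k \<circ> x"
      have h: "?h permutes {1..n}" "colour E \<circ> ?h = colour E"
        using True unfolding mem_young_subgroup_iff[OF E] by auto
      have xh: "x \<circ> ?h = k \<circ> x"
        using x'(2) by (simp add: comp_assoc[symmetric])
      have "colour D \<circ> x \<circ> ?h = colour D \<circ> k \<circ> x"
        unfolding comp_assoc[of "colour D" x] xh by (simp add: comp_assoc)
      then have D': "colour D \<circ> x \<circ> ?h = colour D \<circ> x"
        using k unfolding mem_young_subgroup_iff[OF D] by simp
      \<comment> \<open>Conjugation by \<open>x\<close> makes \<open>?h\<close> preserve both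
        colours of a position, and by \<open>inj\<close> the two colours determine the
        position.\<close>
      have "?h p = p" for p
      proof (cases "p \<in> {1..n}")
        case True
        have "colour E (?h p) = colour E p" "colour D (x (?h p)) = colour D (x p)"
          using h(2) D' unfolding fun_eq_iff comp_apply by blast+
        then show ?thesis
          using inj_onD[OF inj, of "?h p" p] True permutes_in_image[OF h(1), of p] by simp
      next
        case False
        then show ?thesis
          using h(1) unfolding permutes_def by blast
      qed
      then have "?h = id"
        by (simp add: fun_eq_iff)
      then have "k \<circ> x = x" and "sgn_gen n E ?h = 1"
        using xh id_young_subgroup by (simp_all add: sgn_gen_def)
      moreover have "k = k \<circ> x \<circ> inv' x"
        using x'(2) by (simp add: comp_assoc)
      ultimately show ?thesis
        using x'(2) by simp
    next
      case False
      then have "k \<noteq> id"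
        using x'(3) id_young_subgroup by auto
      then show ?thesis
        using False by (simp add: sgn_gen_def)
    qed
    then have "F (sgn_gen n E) x = (\<Sum>k\<in>?K. if k = id then 1 else 0)"
      using x(1) sgn_gen_in by (simp add: F_def)
    then show ?thesis
      using id_young_subgroup finite_young_subgroup by simp
  qed
  then have "F \<noteq> 0" by (auto simp: fun_eq_iff)
  ultimately show ?thesis by blast
qed

lemma nonzero_intertwiner_iff:
  assumes D: "sum_list D = n" and E: "sum_list E = n"
  shows "(\<exists>F\<in>intertwiners (sym_group n) (young_module_sgn n E) (young_module n D). F \<noteq> 0) \<longleftrightarrow>
    (\<exists>S. zero_one E D S)"
proof
  assume "\<exists>F\<in>intertwiners (sym_group n) (young_module_sgn n E) (young_module n D). F \<noteq> 0"
  then obtain F where F: "F \<in> intertwiners (sym_group n) (young_module_sgn n E) (young_module n D)"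
    and "F \<noteq> 0"
    by blast
  then have "F (sgn_gen n E) \<noteq> 0"
    using intertwiner_eq_0_if_sgn_gen is_rep_young_module by blast
  then obtain x where nz: "F (sgn_gen n E) x \<noteq> 0"
    by (auto simp: fun_eq_iff)
  then have x: "x permutes {1..n}"
    using image_sgn_gen(1)[OF D F] unfolding mem_young_module_iff[OF D] by blast
  have "colour D \<circ> x \<in> words n D"
    using words_comp_iff[OF x] colour_in_words[OF D] by blast
  then show "\<exists>S. zero_one E D S"
    using zero_one_if_inj[OF colour_in_words[OF E] _ image_sgn_gen_support[OF D E F x, OF nz]]
    by fast
qed (use nonzero_intertwiner[OF D E] in blast)

text \<open>The matrix is unique, so the support of \<psi> lies in one double coset, where \<psi> is
  determined by its value at one point \<open>x\<close>. Hence all intertwiners are multiples of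
  one.\<close>

lemma intertwining_number_transpose:
  assumes "D \<in> young_diagrams n"
  shows "intertwining_number (sym_group n) (young_module_sgn n (transpose_diagram D))
    (young_module n D) = 1"
proof -
  let ?E = "transpose_diagram D"
  let ?I = "intertwiners (sym_group n) (young_module_sgn n ?E) (young_module n D)"
  have D: "sum_list D = n" and E: "sum_list ?E = n"
    using assms transpose_diagram_in[OF assms] by (auto simp: sum_list_diagram)
  have sub: "complex_vector.subspace ?I"
    by (intro subspace_intertwiners is_rep_young_module is_rep_young_module_sgn)
  obtain F\<^sub>0 where F\<^sub>0: "F\<^sub>0 \<in> ?I" "F\<^sub>0 \<noteq> 0"
    using nonzero_intertwiner[OF D E zero_one_transpose[OF assms]] by blast
  let ?\<psi> = "F\<^sub>0 (sgn_gen n ?E)"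
  have "?\<psi> \<noteq> 0"
    using F\<^sub>0 intertwiner_eq_0_if_sgn_gen is_rep_young_module by blast
  then obtain x where nz: "?\<psi> x \<noteq> 0"
    by (auto simp: fun_eq_iff)
  then have x: "x permutes {1..n}"
    using image_sgn_gen(1)[OF D F\<^sub>0(1)] unfolding mem_young_module_iff[OF D] by blast
  let ?pair = "\<lambda>y p. (colour ?E p, (colour D \<circ> y) p)"
  have im: "?pair y ` {1..n} = {(r, s). r < row D s}"
    if y: "y permutes {1..n}" and "inj_on (?pair y) {1..n}" for y
  proof (rule zero_one_transpose_unique[OF _ assms])
    have "colour D \<circ> y \<in> words n D"
      using words_comp_iff[OF y] colour_in_words[OF D] by blast
    then show "zero_one ?E D (?pair y ` {1..n})"
      by (rule zero_one_if_inj[OF colour_in_words[OF E] _ that(2)])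
  qed
  have inj_x: "inj_on (?pair x) {1..n}"
    by (rule image_sgn_gen_support[OF D E F\<^sub>0(1) x, OF nz])
  \<comment> \<open>Both pair maps are injective with the same image, so some \<open>h\<close>
    matches them. The first component puts \<open>h\<close> in S_E, the second puts
    \<open>y \<circ> h\<close> in the coset S_D x.\<close>
  have coset: "\<exists>h\<in>young_subgroup n ?E. colour D \<circ> (y \<circ> h) = colour D \<circ> x"
    if y: "y permutes {1..n}" and inj: "inj_on (?pair y) {1..n}" for y
  proof -
    have "image_mset (?pair x) (mset_set {1..n}) = image_mset (?pair y) (mset_set {1..n})"
      unfolding image_mset_mset_set[OF inj_x] image_mset_mset_set[OF inj] im[OF x inj_x]
        im[OF y inj] ..
    then obtain h where h: "h permutes {1..n}" "\<forall>p\<in>{1..n}. ?pair x p = ?pair y (h p)"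
      using image_mset_eq_implies_permutes[of "{1..n}" "?pair x" "?pair y"] by blast
    have out: "h p = p" "x p = p" "y p = p" if "p \<notin> {1..n}" for p
      using that h(1) x y unfolding permutes_def by blast+
    have "colour ?E (h p) = colour ?E p \<and> colour D (y (h p)) = colour D (x p)" for p
      using h(2) out[of p] by (cases "p \<in> {1..n}") (simp_all del: atLeastAtMost_iff)
    then have "colour ?E \<circ> h = colour ?E" "colour D \<circ> (y \<circ> h) = colour D \<circ> x"
      by (simp_all add: fun_eq_iff)
    then show ?thesis
      using h(1) mem_young_subgroup_iff[OF E] by blast
  qed
  have "F = (F (sgn_gen n ?E) x / ?\<psi> x) *\<^sub>C F\<^sub>0" if F: "F \<in> ?I" for F
  proof -
    let ?c = "F (sgn_gen n ?E) x / ?\<psi> x"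
    \<comment> \<open>The multiple of \<open>F\<^sub>0\<close> is chosen so that the difference
      vanishes at \<open>x\<close>, and therefore on the whole double coset.\<close>
    let ?F = "F - ?c *\<^sub>C F\<^sub>0"
    have F': "?F \<in> ?I"
      by (intro complex_vector.subspace_diff[OF sub] complex_vector.subspace_scale[OF sub] F F\<^sub>0)
    have x0: "?F (sgn_gen n ?E) x = 0"
      using nz by (simp add: scaleC_complex_def)
    have "?F (sgn_gen n ?E) y = 0" for y
    proof (rule ccontr)
      assume nz': "?F (sgn_gen n ?E) y \<noteq> 0"
      then have y: "y permutes {1..n}"
        using image_sgn_gen(1)[OF D F'] unfolding mem_young_module_iff[OF D] by blast
      obtain h where h: "h \<in> young_subgroup n ?E" "colour D \<circ> (y \<circ> h) = colour D \<circ> x"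
        using coset[OF y image_sgn_gen_support[OF D E F' y, OF nz']] by blast
      have "y \<circ> h permutes {1..n}"
        by (intro permutes_compose y young_subgroup_permutes[OF h(1)])
      then have "?F (sgn_gen n ?E) (y \<circ> h) = ?F (sgn_gen n ?E) x"
        using image_sgn_gen(1)[OF D F'] x h(2) unfolding mem_young_module_iff[OF D] by blast
      then have "of_int (sign h) * ?F (sgn_gen n ?E) y = 0"
        unfolding image_sgn_gen(2)[OF D F' y h(1)] x0 .
      then show False
        using nz' by simp
    qed
    then have "?F (sgn_gen n ?E) = 0"
      by (intro ext) (simp only: zero_fun_apply)
    then have "?F = 0"
      by (rule intertwiner_eq_0_if_sgn_gen[OF F' is_rep_young_module])
    then show ?thesis by simp
  qed
  then have "?I \<subseteq> complex_vector.span {F\<^sub>0}"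
    unfolding complex_vector.span_singleton by blast
  moreover have "complex_vector.independent {F\<^sub>0}"
    using F\<^sub>0(2) by simp
  ultimately have "complex_vector.dim ?I = card {F\<^sub>0}"
    using F\<^sub>0(1) by (intro complex_vector.dim_unique[of "{F\<^sub>0}"]) auto
  then show ?thesis
    by (simp add: intertwining_number_def)
qed

text \<open>Injectivity keeps the composite with the map from the module of E^t nonzero; the matrix
  it yields bounds the partial sums of E^t by those of D^t.\<close>

lemma psum_le_if_rep_embeds:
  assumes D: "D \<in> young_diagrams n" and E: "E \<in> young_diagrams n"
    and "rep_embeds (sym_group n) (young_module n E) (young_module n D)"
  shows "psum D m \<le> psum E m"
proof -
  let ?E = "transpose_diagram E"
  have sE: "sum_list E = n" "sum_list ?E = n" and sD: "sum_list D = n"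
    using D E transpose_diagram_in[OF E] by (auto simp: sum_list_diagram)
  obtain f where f: "f \<in> intertwiners (sym_group n) (young_module n E) (young_module n D)"
    and inj: "inj_on f (vspace (young_module n E))"
    using assms(3) unfolding rep_embeds_def by blast
  obtain F where F: "F \<in> intertwiners (sym_group n) (young_module_sgn n ?E) (young_module n E)"
    and "F \<noteq> 0"
    using nonzero_intertwiner[OF sE zero_one_transpose[OF E]] by blast
  then obtain v where v: "F v \<noteq> 0"
    by (auto simp: fun_eq_iff)
  then have "F v \<in> vspace (young_module n E)"
    using intertwinersD(1,2)[OF F] by blast
  moreover have zero: "0 \<in> vspace (young_module n E)"
    using is_rep_young_module[of n E] complex_vector.subspace_0 unfolding is_rep_def by blast
  moreover have "f 0 = 0"
    by (rule clinear_on_zero[OF intertwinersD(3)[OF f] zero])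
  ultimately have "f (F v) \<noteq> 0"
    using v inj_onD[OF inj, of "F v" 0] by auto
  then have "f \<circ> F \<noteq> 0"
    by (metis comp_apply zero_fun_apply)
  then obtain S where "zero_one ?E D S"
    using nonzero_intertwiner_iff[OF sD sE(2)] intertwiners_comp[OF F f is_rep_young_module] by blast
  then have "(\<Sum>i<n. min (row E i) k) \<le> (\<Sum>i<n. min (row D i) k)" for k
    using psum_le_if_zero_one[OF _ D, of ?E S k] psum_transpose_diagram[OF E, of k] by simp
  then show ?thesis
    by (rule psum_le_if_sum_min_le[OF D E])
qed

theorem theorem2p2p1:
  fixes n :: nat and D E :: "nat list"
  assumes "n \<ge> 1" and "D \<in> young_diagrams n" and "E \<in> young_diagrams n"
  shows "((intertwining_number (sym_group n) (young_module_sgn n E) (young_module n D) = 0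
            \<longleftrightarrow> \<not> dominance n E (transpose_diagram D)) \<and>
          (E = transpose_diagram D \<longrightarrow>
            intertwining_number (sym_group n) (young_module_sgn n E) (young_module n D) = 1)) \<and>
         (dominance n D E \<and> D \<noteq> E
            \<longleftrightarrow> iso_proper_subrep (sym_group n) (young_module n E) (young_module n D))"
proof (intro conjI)
  note D = assms(2) and E = assms(3)
  let ?G = "sym_group n"
  have sum: "sum_list D = n" "sum_list E = n"
    using D E by (auto simp: sum_list_diagram)
  show "intertwining_number ?G (young_module_sgn n E) (young_module n D) = 0
      \<longleftrightarrow> \<not> dominance n E (transpose_diagram D)"
    using nonzero_intertwiner_iff[OF sum] dominance_iff_zero_one[OF D E]
    unfolding intertwining_number_eq_0_iff[OF is_rep_young_module_sgn is_rep_young_module] by blast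
  show "E = transpose_diagram D \<longrightarrow>
      intertwining_number ?G (young_module_sgn n E) (young_module n D) = 1"
    using intertwining_number_transpose[OF D] by blast
  show "dominance n D E \<and> D \<noteq> E \<longleftrightarrow> iso_proper_subrep ?G (young_module n E) (young_module n D)"
    unfolding iso_proper_subrep_iff[OF is_rep_young_module is_rep_young_module]
  proof
    assume DE: "dominance n D E \<and> D \<noteq> E"
    then have emb: "rep_embeds ?G (young_module n E) (young_module n D)"
      by (simp add: rep_embeds_dominance)
    then obtain f where f: "f \<in> intertwiners ?G (young_module n E) (young_module n D)"
      and inj: "inj_on f (vspace (young_module n E))"
      unfolding rep_embeds_def by blast
    \<comment> \<open>Were \<open>f\<close> onto, its inverse would embed the modules the other way
      round, and the two inequalities of partial sums would force \<open>D = E\<close>.\<close>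
    have "f ` vspace (young_module n E) \<noteq> vspace (young_module n D)"
    proof
      assume "f ` vspace (young_module n E) = vspace (young_module n D)"
      then have "rep_embeds ?G (young_module n D) (young_module n E)"
        by (rule rep_embeds_inverse[OF f inj _ is_rep_young_module])
      then have "psum D k = psum E k" for k
        using psum_le_if_rep_embeds[OF D E emb] psum_le_if_rep_embeds[OF E D]
        by (meson order_antisym)
      then show False
        using psum_inj[OF D E] DE by blast
    qed
    then show "\<exists>f\<in>intertwiners ?G (young_module n E) (young_module n D).
        inj_on f (vspace (young_module n E)) \<and>
        f ` vspace (young_module n E) \<noteq> vspace (young_module n D)"
      using f inj by blast
  next
    assume "\<exists>f\<in>intertwiners ?G (young_module n E) (young_module n D).
        inj_on f (vspace (young_module n E)) \<and>
        f ` vspace (young_module n E) \<noteq> vspace (young_module n D)"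
    then obtain f where f: "f \<in> intertwiners ?G (young_module n E) (young_module n D)"
      and inj: "inj_on f (vspace (young_module n E))"
      and ne: "f ` vspace (young_module n E) \<noteq> vspace (young_module n D)"
      by blast
    then have "rep_embeds ?G (young_module n E) (young_module n D)"
      unfolding rep_embeds_def by blast
    then have "dominance n D E"
      using psum_le_if_rep_embeds[OF D E] dominance_if_psum_le[OF D E] by blast
    \<comment> \<open>For equal diagrams \<open>f\<close> would be an injective endomorphism of a
      finite-dimensional space, hence onto.\<close>
    moreover have "D \<noteq> E"
    proof
      assume "D = E"
      have V: "complex_vector.subspace (vspace (young_module n D))"
        "fin_dim (vspace (young_module n D))"
        using is_rep_young_module[of n D] unfolding is_rep_def by blast+
      have "f ` vspace (young_module n D) = vspace (young_module n D)"
        using f inj unfolding \<open>D = E\<close>[symmetric]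
        by (intro clinear_on_inj_on_surj V intertwinersD(3)) (auto dest: intertwinersD(2))
      then show False
        using ne \<open>D = E\<close> by simp
    qed
    ultimately show "dominance n D E \<and> D \<noteq> E"
      by blast
  qed
qed

end
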